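(* Let $\omega\in A_{1}$ be a weight on $\mathbb{R}^n$, let $1<p<\infty$, and let $X=L^{p,\infty}(\omega)$. Then ${\rm BMO}(\omega)={\rm BMO}_{X}(\omega)$ with equivalence of the corresponding norms; that is, the two sets of functions coincide and there is a constant $C\ge 1$ such that $C^{-1}\|f\|_{{\rm BMO}(\omega)}\le \|f\|_{{\rm BMO}_{X}(\omega)}\le C\|f\|_{{\rm BMO}(\omega)}$ for all such $f$.
   Context: Cubes $Q\subset\mathbb{R}^n$ have sides parallel to the axes; $\omega(E)=\int_E\omega(x)\,dx$ and $f_Q=\frac{1}{|Q|}\int_Q f(x)\,dx$. A nonnegative locally integrable function $\omega$ on $\mathbb{R}^n$ belongs to $A_1$ if $[\omega]_{A_1}:=\sup_Q \left(\frac{1}{|Q|}\int_Q\omega(x)\,dx\right)\operatorname{ess\,sup}_{x\in Q}\omega(x)^{-1}<\infty$. $L^{p,\infty}(\omega)$ is the weighted weak Lebesgue space with $\|f\|_{L^{p,\infty}(\omega)}=\sup_{\lambda>0}\lambda\,\omega(\{x:|f(x)|>\lambda\})^{1/p}$. ${\rm BMO}(\omega)$ is the set of $f\in L^1_{\rm loc}(\mathbb{R}^n)$ with $\|f\|_{{\rm BMO}(\omega)}=\sup_Q\frac{1}{\omega(Q)}\int_Q|f(y)-f_Q|\,dy<\infty$. For a quasi-Banach function space $X$, ${\rm BMO}_X(\omega)$ is the set of $f\in L^1_{\rm loc}(\mathbb{R}^n)$ with $\|f\|_{{\rm BMO}_X(\omega)}=\sup_Q\frac{1}{\|\chi_Q\|_X}\left\|\frac{(f-f_Q)\chi_Q}{\omega}\right\|_X<\infty$.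 *)

theory Defs
  imports "HOL-Probability.Essential_Supremum"
begin

text \<open>
  Functions are defined on \<open>real ^ 'n\<close> with Lebesgue measure and take values in \<open>'b\<close>. In the
  class \<open>{real_normed_field, banach}\<close>, \<open>'b\<close> is (by Gelfand--Mazur) the real or the complex numbers.
  All norms are \<open>ennreal\<close>-valued, so that they are defined for every function, and
  membership in a space includes finiteness of its norm.
\<close>

definition cubes :: "(real ^ 'n) set set" where
  "cubes = {Q. \<exists>a l. l > 0 \<and> Q = cbox a (a + vec l)}"

definition locally_integrable :: "(real ^ 'n \<Rightarrow> 'b::{banach, second_countable_topology}) \<Rightarrow> bool" where
  "locally_integrable f \<longleftrightarrow> (\<forall>K. compact K \<longrightarrow> set_integrable lebesgue K f)"

definition avg :: "(real ^ 'n) set \<Rightarrow> (real ^ 'n \<Rightarrow> 'b::{banach, second_countable_topology}) \<Rightarrow> 'b" where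
  "avg Q f = (1 / measure lebesgue Q) *\<^sub>R set_lebesgue_integral lebesgue Q f"

text \<open>
  A weight is not almost everywhere zero. The zero function has to be excluded explicitly:
  for it the product defining the \<open>A\<^sub>1\<close> constant is \<open>0 \<cdot> \<infinity>\<close>, which is \<open>0\<close> in \<open>ennreal\<close>.
  Positivity almost everywhere follows from finiteness of the \<open>A\<^sub>1\<close> constant, since
  \<open>inverse 0 = \<infinity>\<close> in \<open>ennreal\<close>.
\<close>

definition weight :: "(real ^ 'n \<Rightarrow> real) \<Rightarrow> bool" where
  "weight \<omega> \<longleftrightarrow> (\<forall>x. 0 \<le> \<omega> x) \<and> locally_integrable \<omega> \<and> \<not> (AE x in lebesgue. \<omega> x = 0)"

definition wmeas :: "(real ^ 'n \<Rightarrow> real) \<Rightarrow> (real ^ 'n) set \<Rightarrow> ennreal" where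
  "wmeas \<omega> E = (\<integral>\<^sup>+x\<in>E. ennreal (\<omega> x) \<partial>lebesgue)"

definition A1_const :: "(real ^ 'n \<Rightarrow> real) \<Rightarrow> ennreal" where
  "A1_const \<omega> = (SUP Q\<in>cubes. (wmeas \<omega> Q / emeasure lebesgue Q) *
      esssup (lebesgue_on Q) (\<lambda>x. inverse (ennreal (\<omega> x))))"

definition A1 :: "(real ^ 'n \<Rightarrow> real) set" where
  "A1 = {\<omega>. weight \<omega> \<and> A1_const \<omega> < \<infinity>}"

text \<open>Real powers in \<open>ennreal\<close>, for exponents \<open>a > 0\<close> only.\<close>

definition epowr :: "ennreal \<Rightarrow> real \<Rightarrow> ennreal" where
  "epowr x a = (if x = \<infinity> then \<infinity> else ennreal (enn2real x powr a))"

definition weak_Lp_norm ::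
  "real \<Rightarrow> (real ^ 'n \<Rightarrow> real) \<Rightarrow> (real ^ 'n \<Rightarrow> 'b::real_normed_vector) \<Rightarrow> ennreal" where
  "weak_Lp_norm p \<omega> f =
     (SUP t\<in>{0<..}. ennreal t * epowr (wmeas \<omega> {x. norm (f x) > t}) (1 / p))"

definition BMO_norm ::
  "(real ^ 'n \<Rightarrow> real) \<Rightarrow> (real ^ 'n \<Rightarrow> 'b::{banach, second_countable_topology}) \<Rightarrow> ennreal" where
  "BMO_norm \<omega> f =
     (SUP Q\<in>cubes. (\<integral>\<^sup>+y\<in>Q. ennreal (norm (f y - avg Q f)) \<partial>lebesgue) / wmeas \<omega> Q)"

definition BMO ::
  "(real ^ 'n \<Rightarrow> real) \<Rightarrow> (real ^ 'n \<Rightarrow> 'b::{banach, second_countable_topology}) set" where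
  "BMO \<omega> = {f. locally_integrable f \<and> BMO_norm \<omega> f < \<infinity>}"

text \<open>
  A quasi-Banach function space \<open>X\<close> enters through its quasi-norm, extended by \<open>\<infinity>\<close> to the
  functions outside \<open>X\<close>. The value of the quotient at zeros of \<open>\<omega>\<close> is irrelevant for \<open>A\<^sub>1\<close>
  weights, which are positive almost everywhere.
\<close>

definition BMO_X_norm ::
  "((real ^ 'n \<Rightarrow> 'b) \<Rightarrow> ennreal) \<Rightarrow> (real ^ 'n \<Rightarrow> real) \<Rightarrow>
   (real ^ 'n \<Rightarrow> 'b::{real_normed_field, banach, second_countable_topology}) \<Rightarrow> ennreal" where
  "BMO_X_norm X \<omega> f =
     (SUP Q\<in>cubes. X (\<lambda>x. (f x - avg Q f) * indicator Q x / of_real (\<omega> x)) / X (indicator Q))"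

definition BMO_X ::
  "((real ^ 'n \<Rightarrow> 'b) \<Rightarrow> ennreal) \<Rightarrow> (real ^ 'n \<Rightarrow> real) \<Rightarrow>
   (real ^ 'n \<Rightarrow> 'b::{real_normed_field, banach, second_countable_topology}) set" where
  "BMO_X X \<omega> = {f. locally_integrable f \<and> BMO_X_norm X \<omega> f < \<infinity>}"

end

theory Submission
  imports Defs
begin

text \<open>
  By Hoelder's inequality in its weak form (a dyadic layer-cake sum), a bound on the weak norm of
  \<open>(f - f\<^sub>Q) / \<omega>\<close> over \<open>Q\<close> bounds the integral of \<open>\<bar>f - f\<^sub>Q\<bar>\<close>; the sum converges since \<open>p > 1\<close>.

  The converse is a John--Nirenberg argument. Stop the dyadic subcubes of \<open>Q\<close> when the average of
  \<open>\<bar>f - f\<^sub>Q\<bar>\<close> exceeds \<open>2 B \<omega>(Q) / \<bar>Q\<bar>\<close>, where \<open>B\<close> bounds the norm of \<open>f\<close> in \<open>BMO(\<omega>)\<close>. The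
  stopping cubes fill at most half of \<open>Q\<close>, so by \<open>A\<^sub>1\<close> they carry at most the fraction
  \<open>1 - 1 / (2 A)\<close> of \<open>\<omega>(Q)\<close>. As \<open>\<omega>(Q) / \<bar>Q\<bar> \<le> A \<omega>\<close> almost everywhere on \<open>Q\<close>, passing from \<open>Q\<close> to a
  stopping cube changes \<open>f\<^sub>Q / \<omega>\<close> by at most a constant multiple of \<open>B\<close>. Iterating, the
  \<open>\<omega>\<close>-measure of the set where \<open>\<bar>f - f\<^sub>Q\<bar> / \<omega> > t\<close> decays exponentially in \<open>t / B\<close>.
\<close>

text \<open>As a simp rule it would replace the Lebesgue measure of a set by the Borel measure of
  its main part.\<close>

declare emeasure_completion [simp del]

section \<open>Half-open and dyadic cubes\<close>

text \<open>Half-open, so that the dyadic subcubes of one level partition the cube exactly.\<close>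

definition hcube :: "real ^ 'n \<Rightarrow> real \<Rightarrow> (real ^ 'n) set" where
  "hcube a l = {x. \<forall>i. a $ i \<le> x $ i \<and> x $ i < a $ i + l}"

lemma hcube_subset_cbox: "hcube a l \<subseteq> cbox a (a + vec l)"
  by (auto simp: hcube_def mem_box_cart less_imp_le)

lemma cbox_diff_hcube_null: "cbox a (a + vec l) - hcube a l \<in> null_sets lebesgue"
proof -
  have "cbox a (a + vec l) - hcube a l \<subseteq> cbox a (a + vec l) - box a (a + vec l)"
    by (auto simp: hcube_def mem_box_cart less_imp_le)
  then show ?thesis
    using negligible_subset[OF negligible_frontier_interval] by (metis negligible_iff_null_sets)
qed

lemma hcube_eq_Diff: "hcube a l = cbox a (a + vec l) - (cbox a (a + vec l) - hcube a l)"
  using hcube_subset_cbox by blast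

lemma sets_hcube [measurable, simp]: "hcube a l \<in> sets lebesgue"
  by (subst hcube_eq_Diff) (intro sets.Diff lmeasurable_cbox fmeasurableD null_setsD2[OF cbox_diff_hcube_null])

lemma AE_hcube_cbox: "AE x in lebesgue. x \<in> hcube a l \<longleftrightarrow> x \<in> cbox a (a + vec l)"
  using AE_not_in[OF cbox_diff_hcube_null[of a l]] hcube_subset_cbox[of a l]
  by (auto elim!: eventually_mono)

lemma emeasure_cbox_cube:
  "emeasure lebesgue (cbox a (a + vec l)) = emeasure lebesgue (hcube a l)"
  by (rule emeasure_eq_AE) (use AE_hcube_cbox[of a l] in \<open>auto elim: eventually_mono\<close>)

lemma emeasure_hcube:
  assumes "l > 0"
  shows "emeasure lebesgue (hcube (a :: real ^ 'n) l) = ennreal (l ^ CARD('n))"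
proof -
  have "emeasure lebesgue (hcube a l) = emeasure lebesgue (cbox a (a + vec l))"
    by (rule emeasure_cbox_cube[symmetric])
  also have "\<dots> = ennreal (measure lebesgue (cbox a (a + vec l)))"
    by (rule emeasure_eq_measure2) simp
  also have "measure lebesgue (cbox a (a + vec l)) = l ^ CARD('n)"
    using assms content_cbox_cart[of a "a + vec l"] by (simp add: interval_ne_empty_cart)
  finally show ?thesis .
qed

text \<open>The level \<open>k\<close> cube containing \<open>x\<close>, in the grid with corner
  \<open>a\<close> and side \<open>l / 2 ^ k\<close>, which covers the whole space. As a class of
  the relation "same integer coordinates" it makes the partition property immediate.\<close>

definition dyadic :: "real ^ 'n \<Rightarrow> real \<Rightarrow> nat \<Rightarrow> real ^ 'n \<Rightarrow> (real ^ 'n) set" where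
  "dyadic a l k x = {y. \<forall>i. \<lfloor>(y $ i - a $ i) * 2 ^ k / l\<rfloor> = \<lfloor>(x $ i - a $ i) * 2 ^ k / l\<rfloor>}"

lemma self_in_dyadic [simp]: "x \<in> dyadic a l k x"
  by (simp add: dyadic_def)

lemma dyadic_eq: "y \<in> dyadic a l k x \<Longrightarrow> dyadic a l k y = dyadic a l k x"
  by (simp add: dyadic_def)

lemma dyadic_eq_hcube:
  assumes "l > 0"
  shows "dyadic a l k x = hcube (\<chi> i. a $ i + l * \<lfloor>(x $ i - a $ i) * 2 ^ k / l\<rfloor> / 2 ^ k) (l / 2 ^ k)"
  using assms by (auto simp: dyadic_def hcube_def floor_eq_iff field_simps)

lemma sets_dyadic: "l > 0 \<Longrightarrow> dyadic a l k x \<in> sets lebesgue"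
  by (simp add: dyadic_eq_hcube)

lemma dyadic_0: 
  assumes "l > 0" "x \<in> hcube a l"
  shows "dyadic a l 0 x = hcube a l"
proof -
  have "\<lfloor>(x $ i - a $ i) / l\<rfloor> = 0" for i
    using assms by (auto simp: hcube_def floor_eq_iff field_simps)
  then show ?thesis
    using assms by (simp add: dyadic_eq_hcube)
qed

lemma dyadic_Suc_subset: "dyadic a l (Suc k) x \<subseteq> dyadic a l k x"
proof -
  \<comment> \<open>Halving the integer coordinate at level \<open>k + 1\<close> gives the one at
    level \<open>k\<close>, so the finer class determines the coarser one.\<close>
  have *: "\<lfloor>t * 2 ^ k / l\<rfloor> = \<lfloor>t * 2 ^ Suc k / l\<rfloor> div 2" for t
    using floor_divide_real_eq_div[of 2 "t * 2 ^ Suc k / l"] by simp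
  show ?thesis
    unfolding dyadic_def * by auto
qed

lemma dyadic_antimono: "j \<le> k \<Longrightarrow> dyadic a l k x \<subseteq> dyadic a l j x"
  by (induction rule: dec_induct) (use dyadic_Suc_subset in blast)+

lemma emeasure_dyadic:
  assumes "l > 0"
  shows "emeasure lebesgue (dyadic a l k (x :: real ^ 'n)) = ennreal ((l / 2 ^ k) ^ CARD('n))"
  using assms by (simp add: dyadic_eq_hcube emeasure_hcube)

lemma emeasure_dyadic_parent:
  assumes "l > 0"
  shows "emeasure lebesgue (dyadic a l k (x :: real ^ 'n))
    = 2 ^ CARD('n) * emeasure lebesgue (dyadic a l (Suc k) x)"
proof -
  have "(l / 2 ^ k) ^ CARD('n) = 2 ^ CARD('n) * (l / 2 ^ Suc k) ^ CARD('n)"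
    by (simp flip: power_mult_distrib)
  then show ?thesis
    using assms by (simp add: emeasure_dyadic ennreal_mult flip: ennreal_power)
qed

text \<open>A dyadic cube is determined by its level and an integer vector, and there are countably
  many such pairs.\<close>

lemma countable_dyadic: "countable (range (\<lambda>(k, x). dyadic a l k (x :: real ^ 'n)))"
proof (rule countable_subset)
  show "range (\<lambda>(k, x). dyadic a l k x) \<subseteq>
    range (\<lambda>(k :: nat, m :: int ^ 'n). {y. \<forall>i. \<lfloor>(y $ i - a $ i) * 2 ^ k / l\<rfloor> = m $ i})"
  proof clarify
    fix k :: nat and x
    show "dyadic a l k x \<in> range (\<lambda>(k :: nat, m :: int ^ 'n). {y. \<forall>i. \<lfloor>(y $ i - a $ i) * 2 ^ k / l\<rfloor> = m $ i})"
      by (rule image_eqI[of _ _ "(k, \<chi> i. \<lfloor>(x $ i - a $ i) * 2 ^ k / l\<rfloor>)"]) (auto simp: dyadic_def)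
  qed
qed auto

lemma dyadic_small:
  fixes x :: "real ^ 'n"
  assumes "l > 0" "open U" "x \<in> U"
  shows "\<exists>k. dyadic a l k x \<subseteq> U"
proof -
  obtain e where e: "e > 0" "ball x e \<subseteq> U"
    using assms openE by blast
  \<comment> \<open>The norm is at most the sum of the absolute coordinates, so coordinate
    differences below \<open>e / n\<close> in dimension \<open>n\<close> keep a point in the
    ball.\<close>
  define d where "d = e / real CARD('n)"
  have "d > 0"
    using e by (simp add: d_def)
  obtain k where k: "l / d < 2 ^ k"
    using real_arch_pow[of 2 "l / d"] by auto
  have "y \<in> ball x e" if y: "y \<in> dyadic a l k x" for y
  proof -
    have "\<bar>(x - y) $ i\<bar> < d" for i
    proof -
      have "\<lfloor>(y $ i - a $ i) * 2 ^ k / l\<rfloor> = \<lfloor>(x $ i - a $ i) * 2 ^ k / l\<rfloor>"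
        using y by (simp add: dyadic_def)
      then have "\<bar>(x $ i - a $ i) * 2 ^ k / l - (y $ i - a $ i) * 2 ^ k / l\<bar> < 1"
        by linarith
      also have "(x $ i - a $ i) * 2 ^ k / l - (y $ i - a $ i) * 2 ^ k / l = (x - y) $ i * (2 ^ k / l)"
        using assms by (simp add: diff_divide_distrib left_diff_distrib)
      finally have "\<bar>(x - y) $ i\<bar> * (2 ^ k / l) < 1"
        using assms by (simp add: abs_mult)
      then have "\<bar>(x - y) $ i\<bar> < l / 2 ^ k"
        using assms by (simp add: field_simps)
      also have "\<dots> < d"
        using k \<open>d > 0\<close> by (simp add: field_simps)
      finally show ?thesis .
    qed
    then have "(\<Sum>i\<in>UNIV. \<bar>(x - y) $ i\<bar>) < (\<Sum>i\<in>(UNIV :: 'n set). d)"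
      by (intro sum_strict_mono) auto
    then have "norm (x - y) < e"
      using norm_le_l1_cart[of "x - y"] by (simp add: d_def)
    then show ?thesis
      by (simp add: dist_norm)
  qed
  then show ?thesis
    using e by blast
qed

section \<open>The Calderon--Zygmund decomposition\<close>

text \<open>
  Picks the maximal dyadic cubes with the property \<open>R\<close>; used both for the stopping cubes and, with
  \<open>R H \<longleftrightarrow> H \<subseteq> U\<close>, to tile an open set \<open>U\<close>.
\<close>

lemma dyadic_selection:
  assumes "l > 0"
  obtains F where "countable F" "disjoint F" "{x \<in> S. \<exists>k. R (dyadic a l k x)} \<subseteq> \<Union>F"
    "\<And>H. H \<in> F \<Longrightarrow> \<exists>x\<in>S. \<exists>k. H = dyadic a l k x \<and> R H \<and> (\<forall>j<k. \<not> R (dyadic a l j x))"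
proof
  define F where "F = {dyadic a l k x | k x. x \<in> S \<and> R (dyadic a l k x) \<and> (\<forall>j<k. \<not> R (dyadic a l j x))}"
  show "countable F"
    by (rule countable_subset[OF _ countable_dyadic[of a l]]) (auto simp: F_def)
  show "disjoint F"
  proof (rule disjointI, rule ccontr)
    fix H J assume HJ: "H \<in> F" "J \<in> F" "H \<noteq> J" "H \<inter> J \<noteq> {}"
    obtain k x where H: "H = dyadic a l k x" "R H" "\<forall>j<k. \<not> R (dyadic a l j x)"
      using HJ by (auto simp: F_def)
    obtain k' x' where J: "J = dyadic a l k' x'" "R J" "\<forall>j<k'. \<not> R (dyadic a l j x')"
      using HJ by (auto simp: F_def)
    obtain z where z: "z \<in> H" "z \<in> J"
      using HJ by auto
    \<comment> \<open>The common point \<open>z\<close> shares with \<open>x\<close> every cube of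
      level up to \<open>k\<close>, and with \<open>x'\<close> every cube of level up to
      \<open>k'\<close>. Minimality of both levels forces \<open>k = k'\<close>, and then the cubes
      coincide.\<close>
    have "dyadic a l j z = dyadic a l j x" if "j \<le> k" for j
      using dyadic_antimono[OF that, of a l x] z H by (intro dyadic_eq) auto
    moreover have "dyadic a l j z = dyadic a l j x'" if "j \<le> k'" for j
      using dyadic_antimono[OF that, of a l x'] z J by (intro dyadic_eq) auto
    ultimately have "k = k'" 
      using H J by (metis linorder_neqE_nat less_imp_le order_refl)
    then show False
      using HJ H J z dyadic_eq by metis
  qed
  show "{x \<in> S. \<exists>k. R (dyadic a l k x)} \<subseteq> \<Union>F"
  proof clarify
    fix x k assume "x \<in> S" "R (dyadic a l k x)"
    define m where "m = (LEAST k. R (dyadic a l k x))"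
    have "dyadic a l m x \<in> F"
      unfolding F_def
    proof (intro CollectI exI conjI allI impI)
      show "R (dyadic a l m x)"
        unfolding m_def by (rule LeastI[of "\<lambda>k. R (dyadic a l k x)"]) fact
      show "\<not> R (dyadic a l j x)" if "j < m" for j
        using not_less_Least[of j "\<lambda>k. R (dyadic a l k x)"] that by (simp add: m_def)
    qed (use \<open>x \<in> S\<close> in auto)
    then show "x \<in> \<Union>F"
      using self_in_dyadic by blast
  qed
  show "\<exists>x\<in>S. \<exists>k. H = dyadic a l k x \<and> R H \<and> (\<forall>j<k. \<not> R (dyadic a l j x))" if "H \<in> F" for H
    using that by (auto simp: F_def)
qed

text \<open>Countable additivity on both sides. Two measures are allowed in order to compare
  densities with Lebesgue measure, and subsets \<open>X H\<close> in order to sum the exceptional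
  sets inside stopping cubes.\<close>

lemma emeasure_UN_mono_mult:
  assumes "countable F" "disjoint F" "\<And>H. H \<in> F \<Longrightarrow> X H \<in> sets M" "\<And>H. H \<in> F \<Longrightarrow> H \<in> sets N"
    "\<And>H. H \<in> F \<Longrightarrow> X H \<subseteq> H" "\<And>H. H \<in> F \<Longrightarrow> emeasure M (X H) \<le> c * emeasure N H"
  shows "emeasure M (\<Union>H\<in>F. X H) \<le> c * emeasure N (\<Union>F)"
proof -
  have N: "emeasure N (\<Union>F) = (\<integral>\<^sup>+H. emeasure N H \<partial>count_space F)"
    using emeasure_UN_countable[of F "\<lambda>H. H" N] assms
    by (simp add: disjoint_def disjoint_family_on_def)
  have "disjoint_family_on X F"
    unfolding disjoint_family_on_def
  proof clarify
    fix H J assume "H \<in> F" "J \<in> F" "H \<noteq> J"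
    then show "X H \<inter> X J = {}"
      using disjointD[OF assms(2), of H J] assms(5)[of H] assms(5)[of J] by auto
  qed
  then have "emeasure M (\<Union>H\<in>F. X H) = (\<integral>\<^sup>+H. emeasure M (X H) \<partial>count_space F)"
    using assms by (intro emeasure_UN_countable) auto
  also have "\<dots> \<le> (\<integral>\<^sup>+H. c * emeasure N H \<partial>count_space F)"
    using assms by (intro nn_integral_mono) auto
  finally show ?thesis
    by (simp add: N nn_integral_cmult)
qed

lemmas emeasure_Union_mono_mult = emeasure_UN_mono_mult[where X = "\<lambda>H. H", simplified]

text \<open>
  A substitute for Lebesgue differentiation: on \<open>E = {x \<in> S. g x \<ge> L + 1 / (n + 1)}\<close>, covered by
  dyadic cubes inside an open set of measure at most \<open>\<bar>E\<bar> + d\<close>, the integral of \<open>g\<close> is at least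
  \<open>(L + 1 / (n + 1)) \<bar>E\<bar>\<close> and at most \<open>L (\<bar>E\<bar> + d)\<close>.
\<close>

lemma dyadic_averages_bound_AE:
  fixes g :: "real ^ 'n \<Rightarrow> ennreal" and L :: real
  assumes g [measurable]: "g \<in> borel_measurable lebesgue" and "l > 0" "L \<ge> 0"
    and S [measurable]: "S \<in> sets lebesgue" and bdd: "emeasure lebesgue S < \<infinity>"
    and avg: "\<And>k x. x \<in> S \<Longrightarrow> (\<integral>\<^sup>+y\<in>dyadic a l k x. g y \<partial>lebesgue) \<le> L * emeasure lebesgue (dyadic a l k x)"
  shows "AE x in lebesgue. x \<in> S \<longrightarrow> g x \<le> L"
proof -
  define E where "E n = {x \<in> S. g x \<ge> ennreal (L + 1 / Suc n)}" for n
  have E [measurable]: "E n \<in> sets lebesgue" for n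
    unfolding E_def by measurable
  have null: "emeasure lebesgue (E n) = 0" for n
  proof -
    have "emeasure lebesgue (E n) \<le> emeasure lebesgue S"
      by (rule emeasure_mono) (auto simp: E_def)
    then have fin: "emeasure lebesgue (E n) < \<infinity>"
      using bdd by auto
    define e where "e = measure lebesgue (E n)"
    have e: "emeasure lebesgue (E n) = ennreal e" "e \<ge> 0"
      using fin by (auto simp: e_def emeasure_eq_ennreal_measure)
    have "e * (1 / Suc n) \<le> L * d" if d: "d > 0" for d
    proof -
      obtain U where U: "open U" "E n \<subseteq> U" "U - E n \<in> lmeasurable" "emeasure lebesgue (U - E n) < ennreal d"
        using sets_lebesgue_outer_open[OF E[of n] d] by metis
      obtain F where F: "countable F" "disjoint F" 
        and cov: "{x \<in> E n. \<exists>k. dyadic a l k x \<subseteq> U} \<subseteq> \<Union>F"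
        and mem: "\<And>H. H \<in> F \<Longrightarrow> \<exists>x\<in>E n. \<exists>k. H = dyadic a l k x \<and> H \<subseteq> U
           \<and> (\<forall>j<k. \<not> dyadic a l j x \<subseteq> U)"
        using dyadic_selection[OF \<open>l > 0\<close>, of "E n" "\<lambda>H. H \<subseteq> U" a] by (metis (no_types, lifting))
      have sets: "H \<in> sets lebesgue" if "H \<in> F" for H
        using mem[OF that] sets_dyadic[OF \<open>l > 0\<close>] by blast
      have UF [measurable]: "\<Union>F \<in> sets lebesgue"
        using F sets by (intro sets.countable_Union) auto
      have EF: "E n \<subseteq> \<Union>F"
        using cov dyadic_small[OF \<open>l > 0\<close> \<open>open U\<close>] U(2) by blast
      have "ennreal (L + 1 / Suc n) * ennreal e = (\<integral>\<^sup>+x\<in>E n. ennreal (L + 1 / Suc n) \<partial>lebesgue)"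
        by (simp add: nn_integral_cmult_indicator e)
      also have "\<dots> \<le> (\<integral>\<^sup>+x\<in>\<Union>F. g x \<partial>lebesgue)"
        using EF by (intro nn_integral_mono) (auto simp: E_def indicator_def)
      also have "\<dots> = emeasure (density lebesgue g) (\<Union>F)"
        by (simp add: emeasure_density)
      also have "\<dots> \<le> ennreal L * emeasure lebesgue (\<Union>F)"
      proof (rule emeasure_Union_mono_mult[OF F])
        fix H assume H: "H \<in> F"
        then obtain x k where x: "x \<in> E n" "H = dyadic a l k x"
          using mem by blast
        then have "x \<in> S"
          by (simp add: E_def)
        then show "emeasure (density lebesgue g) H \<le> ennreal L * emeasure lebesgue H"
          using avg[of x k] sets[OF H] x by (simp add: emeasure_density)
      qed (use sets in auto)
      also have "emeasure lebesgue (\<Union>F) \<le> emeasure lebesgue (E n \<union> (U - E n))"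
      proof (rule emeasure_mono)
        show "\<Union>F \<subseteq> E n \<union> (U - E n)"
          using mem by blast
        show "E n \<union> (U - E n) \<in> sets lebesgue"
          using U by (intro sets.Un E fmeasurableD)
      qed
      also have "\<dots> \<le> emeasure lebesgue (E n) + emeasure lebesgue (U - E n)"
        using U by (intro emeasure_subadditive) (auto dest: fmeasurableD)
      also have "\<dots> \<le> ennreal e + ennreal d"
        using U e by (intro add_mono) auto
      finally have "ennreal ((L + 1 / Suc n) * e) \<le> ennreal (L * (e + d))"
        using \<open>L \<ge> 0\<close> e(2) d 
        by (simp add: ennreal_mult mult_left_mono flip: ennreal_plus)
      then have "(L + 1 / Suc n) * e \<le> L * (e + d)"
        using \<open>L \<ge> 0\<close> e(2) d by (subst (asm) ennreal_le_iff) auto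
      then show ?thesis
        by (simp add: algebra_simps)
    qed
    note le = this
    have "e * (1 / Suc n) \<le> 0 + t" if "t > 0" for t
    proof -
      \<comment> \<open>Taking \<open>d = t / (L + 1)\<close> makes \<open>L * d\<close> at most
        \<open>t\<close> and stays meaningful for \<open>L = 0\<close>.\<close>
      have "e * (1 / Suc n) \<le> L * (t / (L + 1))"
        by (rule le) (use that \<open>L \<ge> 0\<close> in auto)
      also have "\<dots> \<le> t"
        using that \<open>L \<ge> 0\<close> by (simp add: field_simps)
      finally show ?thesis by simp
    qed
    then have "e * (1 / Suc n) \<le> 0"
      by (rule field_le_epsilon)
    then show ?thesis
      using e by (simp add: field_simps zero_less_mult_iff mult_le_0_iff)
  qed
  have "AE x in lebesgue. \<forall>n. x \<notin> E n"
    unfolding AE_all_countable by (intro allI AE_not_in null_setsI null E)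
  then show ?thesis
  proof eventually_elim
    case (elim x)
    show ?case
    proof (rule impI, rule ennreal_le_epsilon)
      fix e :: real assume "x \<in> S" "e > 0"
      obtain n where "1 / Suc n < e"
        using \<open>e > 0\<close> by (rule nat_approx_posE)
      have "g x < ennreal (L + 1 / Suc n)"
        using elim \<open>x \<in> S\<close> by (auto simp: E_def not_le)
      also have "\<dots> \<le> ennreal (L + e)"
        using \<open>1 / Suc n < e\<close> by (intro ennreal_leI) auto
      finally show "g x \<le> ennreal L + ennreal e"
        using \<open>L \<ge> 0\<close> \<open>e > 0\<close> by (simp add: ennreal_plus)
    qed
  qed
qed

text \<open>\<open>F\<close> consists of the maximal dyadic cubes on which the average of
  \<open>g\<close> exceeds \<open>L\<close>. The parent of such a cube has average at most
  \<open>L\<close> and \<open>2 ^ n\<close> times the volume in dimension \<open>n\<close>, hence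
  the upper bound. Off \<open>F\<close> all dyadic averages are at most \<open>L\<close>, hence so
  is \<open>g\<close> almost everywhere.\<close>

lemma calderon_zygmund:
  fixes g :: "real ^ 'n \<Rightarrow> ennreal" and L :: real
  assumes g [measurable]: "g \<in> borel_measurable lebesgue" and l: "l > 0" "L \<ge> 0"
    and top: "(\<integral>\<^sup>+y\<in>hcube a l. g y \<partial>lebesgue) \<le> L * emeasure lebesgue (hcube a l)"
  obtains F where "countable F" "disjoint F" "\<And>H. H \<in> F \<Longrightarrow> H \<subseteq> hcube a l"
    "\<And>H. H \<in> F \<Longrightarrow> \<exists>b r. r > 0 \<and> H = hcube b r"
    "\<And>H. H \<in> F \<Longrightarrow> L * emeasure lebesgue H \<le> (\<integral>\<^sup>+y\<in>H. g y \<partial>lebesgue)"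
    "\<And>H. H \<in> F \<Longrightarrow> (\<integral>\<^sup>+y\<in>H. g y \<partial>lebesgue) \<le> 2 ^ CARD('n) * (L * emeasure lebesgue H)"
    "AE x in lebesgue. x \<in> hcube a l - \<Union>F \<longrightarrow> g x \<le> L"
proof -
  define R where "R H \<longleftrightarrow> (\<integral>\<^sup>+y\<in>H. g y \<partial>lebesgue) > L * emeasure lebesgue H" for H
  obtain F where F: "countable F" "disjoint F" 
    and cov: "{x \<in> hcube a l. \<exists>k. R (dyadic a l k x)} \<subseteq> \<Union>F"
    and mem: "\<And>H. H \<in> F \<Longrightarrow> \<exists>x\<in>hcube a l. \<exists>k. H = dyadic a l k x \<and> R H
       \<and> (\<forall>j<k. \<not> R (dyadic a l j x))"
    using dyadic_selection[OF \<open>l > 0\<close>, of "hcube a l" R a] by (metis (no_types, lifting))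
  have sub: "\<exists>b r. r > 0 \<and> H = hcube b r" if "H \<in> F" for H
  proof -
    obtain x k where "H = dyadic a l k x"
      using mem[OF \<open>H \<in> F\<close>] by blast
    then show ?thesis
      unfolding dyadic_eq_hcube[OF l(1)] using l(1)
      by (intro exI[of _ "l / 2 ^ k"] exI conjI) (auto intro: divide_pos_pos)
  qed
  have sets: "H \<in> sets lebesgue" if "H \<in> F" for H
    using sub[OF that] by auto
  show thesis
  proof (rule that[OF F])
    fix H assume "H \<in> F"
    then obtain x k where x: "x \<in> hcube a l" "H = dyadic a l k x" "R H" "\<forall>j<k. \<not> R (dyadic a l j x)"
      using mem by blast
    show "H \<subseteq> hcube a l"
      using dyadic_antimono[of 0 k a l x] x dyadic_0[OF l(1) x(1)] by simp
    show "\<exists>b r. r > 0 \<and> H = hcube b r"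
      using sub \<open>H \<in> F\<close> .
    show "L * emeasure lebesgue H \<le> (\<integral>\<^sup>+y\<in>H. g y \<partial>lebesgue)"
      using \<open>R H\<close> by (simp add: R_def)
    \<comment> \<open>The level 0 cube is \<open>hcube a l\<close> itself, which \<open>top\<close>
      keeps from being selected; so every selected cube has a parent inside
      \<open>hcube a l\<close>.\<close>
    have "k \<noteq> 0"
      using top x dyadic_0[OF l(1) x(1)] by (intro notI) (simp add: R_def)
    then obtain j where j: "k = Suc j"
      using not0_implies_Suc by blast
    have "(\<integral>\<^sup>+y\<in>H. g y \<partial>lebesgue) \<le> (\<integral>\<^sup>+y\<in>dyadic a l j x. g y \<partial>lebesgue)"
      using x j dyadic_Suc_subset[of a l j x] by (intro nn_integral_mono) (auto simp: indicator_def)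
    also have "\<dots> \<le> L * emeasure lebesgue (dyadic a l j x)"
      using x j by (simp add: R_def not_less)
    finally show "(\<integral>\<^sup>+y\<in>H. g y \<partial>lebesgue) \<le> 2 ^ CARD('n) * (L * emeasure lebesgue H)"
      using emeasure_dyadic_parent[OF l(1), of a j x] x j by (simp add: mult_ac)
  next
    show "AE x in lebesgue. x \<in> hcube a l - \<Union>F \<longrightarrow> g x \<le> L"
    proof (rule dyadic_averages_bound_AE[OF g l, where a = a])
      show "hcube a l - \<Union>F \<in> sets lebesgue"
        using F sets by (intro sets.Diff sets.countable_Union) auto
      have "emeasure lebesgue (hcube a l - \<Union>F) \<le> emeasure lebesgue (hcube a l)"
        by (rule emeasure_mono) auto
      then show "emeasure lebesgue (hcube a l - \<Union>F) < \<infinity>"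
        using l by (auto simp: emeasure_hcube intro: le_less_trans)
    next
      fix k x assume "x \<in> hcube a l - \<Union>F"
      then have "\<not> R (dyadic a l k x)"
        using cov by blast
      then show "(\<integral>\<^sup>+y\<in>dyadic a l k x. g y \<partial>lebesgue) \<le> L * emeasure lebesgue (dyadic a l k x)"
        by (simp add: R_def)
    qed
  qed
qed

section \<open>Exponential decay of oscillations\<close>

lemma borel_measurable_locally_integrable:
  assumes "locally_integrable f"
  shows "f \<in> borel_measurable lebesgue"
\<comment> \<open>The truncations of \<open>f\<close> to balls around the origin are measurable and,
  at each point, eventually equal to \<open>f\<close>.\<close>
proof (rule borel_measurable_LIMSEQ_metric)
  show "(\<lambda>x. indicator (cball 0 (real n)) x *\<^sub>R f x) \<in> borel_measurable lebesgue" for n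
    using assms unfolding locally_integrable_def set_integrable_def
    by (intro borel_measurable_integrable) auto
  show "(\<lambda>n. indicator (cball 0 (real n)) x *\<^sub>R f x) \<longlonglongrightarrow> f x" for x
  proof (rule tendsto_eventually)
    obtain N where "norm x \<le> real N"
      using real_arch_simple by blast
    then show "\<forall>\<^sub>F n in sequentially. indicator (cball 0 (real n)) x *\<^sub>R f x = f x"
      unfolding eventually_sequentially by (intro exI[of _ N]) (auto simp: indicator_def)
  qed
qed

lemma set_integrable_hcube:
  assumes "locally_integrable f"
  shows "set_integrable lebesgue (hcube a l) f"
proof (rule set_integrable_subset[of _ "cbox a (a + vec l)"])
  show "set_integrable lebesgue (cbox a (a + vec l)) f"
    using assms compact_cbox unfolding locally_integrable_def by blast
qed (simp_all add: hcube_subset_cbox)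

text \<open>The norms are defined with closed cubes, the stopping argument runs on half-open ones;
  they differ by a null set.\<close>

lemma avg_hcube_cbox:
  assumes "locally_integrable f"
  shows "avg (hcube a l) f = avg (cbox a (a + vec l)) f"
proof -
  have [measurable]: "f \<in> borel_measurable lebesgue"
    using assms by (rule borel_measurable_locally_integrable)
  have "measure lebesgue (hcube a l) = measure lebesgue (cbox a (a + vec l))"
    by (rule measure_eq_AE) (use AE_hcube_cbox in auto)
  moreover have "(\<integral>x\<in>hcube a l. f x \<partial>lebesgue) = (\<integral>x\<in>cbox a (a + vec l). f x \<partial>lebesgue)"
    unfolding set_lebesgue_integral_def
  proof (rule integral_cong_AE)
    show "AE x in lebesgue. indicator (hcube a l) x *\<^sub>R f x = indicator (cbox a (a + vec l)) x *\<^sub>R f x"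
      using AE_hcube_cbox[of a l] by eventually_elim (auto simp: indicator_def)
  qed (intro borel_measurable_scaleR borel_measurable_indicator; simp)+
  ultimately show ?thesis
    by (simp add: avg_def)
qed

text \<open>The left side is the norm of the integral of \<open>f - m\<close>. With \<open>m\<close>
  the average over a larger cube, this controls how the average changes on passing to a stopping
  cube.\<close>

lemma norm_avg_diff_le:
  fixes f :: "real ^ 'n \<Rightarrow> 'b :: {banach, second_countable_topology}"
  assumes "locally_integrable f" "l > 0"
  shows "emeasure lebesgue (hcube a l) * norm (avg (hcube a l) f - m)
    \<le> (\<integral>\<^sup>+x\<in>hcube a l. norm (f x - m) \<partial>lebesgue)"
proof -
  define s where "s = measure lebesgue (hcube a l)"
  have s: "emeasure lebesgue (hcube a l) = ennreal s" "s > 0"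
    using assms by (auto simp: s_def emeasure_hcube measure_def)
  have int [simp]: "set_integrable lebesgue (hcube a l) f" "set_integrable lebesgue (hcube a l) (\<lambda>x. m)"
    using s set_integrable_hcube[OF assms(1)] by (auto simp: set_integrable_def)
  have "(\<integral>x\<in>hcube a l. (f x - m) \<partial>lebesgue) = (\<integral>x\<in>hcube a l. f x \<partial>lebesgue) - s *\<^sub>R m"
    unfolding set_integral_diff(2)[OF int] using s by (simp add: s_def set_lebesgue_integral_def)
  also have "\<dots> = s *\<^sub>R (avg (hcube a l) f - m)"
    using s by (simp add: avg_def s_def scaleR_diff_right)
  finally have eq: "s *\<^sub>R (avg (hcube a l) f - m) = (\<integral>x\<in>hcube a l. (f x - m) \<partial>lebesgue)" ..
  have "emeasure lebesgue (hcube a l) * norm (avg (hcube a l) f - m) = norm (s *\<^sub>R (avg (hcube a l) f - m))"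
    using s by (simp add: ennreal_mult)
  also have "\<dots> \<le> (\<integral>\<^sup>+x. norm (indicator (hcube a l) x *\<^sub>R (f x - m)) \<partial>lebesgue)"
    unfolding eq set_lebesgue_integral_def
    using set_integral_diff(1)[OF int] unfolding set_integrable_def by (rule integral_norm_bound_ennreal)
  also have "\<dots> = (\<integral>\<^sup>+x\<in>hcube a l. norm (f x - m) \<partial>lebesgue)"
    by (intro nn_integral_cong) (auto simp: indicator_def)
  finally show ?thesis .
qed

section \<open>Weighted measure and the decay estimate for \<open>A1\<close> weights\<close>

lemma wmeas_eq_emeasure:
  assumes "\<omega> \<in> borel_measurable lebesgue" "E \<in> sets lebesgue"
  shows "wmeas \<omega> E = emeasure (density lebesgue (\<lambda>x. ennreal (\<omega> x))) E"
  using assms by (simp add: wmeas_def emeasure_density)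

lemma wmeas_mono_AE:
  assumes "AE x in lebesgue. x \<in> E \<longrightarrow> x \<in> G"
  shows "wmeas \<omega> E \<le> wmeas \<omega> G"
  unfolding wmeas_def
proof (rule nn_integral_mono_AE)
  show "AE x in lebesgue. ennreal (\<omega> x) * indicator E x \<le> ennreal (\<omega> x) * indicator G x"
    using assms by eventually_elim (simp split: split_indicator)
qed

text \<open>The form of the \<open>A1\<close> condition used below: on half-open cubes, with an
  explicit constant and without division. \<open>A \<ge> 1\<close> keeps the decay factor
  \<open>1 - 1 / (2 * A)\<close> between 1/2 and 1.\<close>

locale A1_weight =
  fixes \<omega> :: "real ^ 'n \<Rightarrow> real" and A :: real
  assumes nonneg: "0 \<le> \<omega> x"
    and meas [measurable]: "\<omega> \<in> borel_measurable lebesgue"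
    and A_ge_1: "A \<ge> 1"
    and wmeas_finite: "l > 0 \<Longrightarrow> wmeas \<omega> (hcube a l) < \<infinity>"
    and wmeas_pos: "l > 0 \<Longrightarrow> wmeas \<omega> (hcube a l) > 0"
    and wmeas_le_A: "l > 0 \<Longrightarrow> AE x in lebesgue. x \<in> hcube a l \<longrightarrow>
      wmeas \<omega> (hcube a l) \<le> ennreal A * emeasure lebesgue (hcube a l) * \<omega> x"
begin

lemma wmeas_hcube_real:
  assumes "l > 0"
  obtains v where "v > 0" "wmeas \<omega> (hcube a l) = ennreal v"
proof (rule that[of "enn2real (wmeas \<omega> (hcube a l))"])
  show "0 < enn2real (wmeas \<omega> (hcube a l))"
    using wmeas_finite[OF assms, of a] wmeas_pos[OF assms, of a] by (simp add: enn2real_positive_iff)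
  show "wmeas \<omega> (hcube a l) = ennreal (enn2real (wmeas \<omega> (hcube a l)))"
    using wmeas_finite[OF assms, of a] by simp
qed

lemma wmeas_le_A_real:
  assumes "l > 0" "wmeas \<omega> (hcube a l) = ennreal v" "v > 0"
  shows "AE x in lebesgue. x \<in> hcube a l \<longrightarrow> v \<le> A * l ^ CARD('n) * \<omega> x"
  using wmeas_le_A[OF assms(1), of a]
proof eventually_elim
  case (elim x)
  have "0 \<le> A * l ^ CARD('n) * \<omega> x"
    using assms A_ge_1 nonneg[of x] by simp
  then show ?case
    using elim assms A_ge_1 nonneg[of x]
    by (simp add: emeasure_hcube ennreal_le_iff flip: ennreal_mult)
qed

text \<open>The complement of \<open>G\<close> has at least half the volume of the cube
  \<open>Q\<close>, and almost everywhere on it \<open>\<omega>\<close> is at least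
  \<open>\<omega>(Q) / (A |Q|)\<close>. So the complement carries at least
  \<open>\<omega>(Q) / (2 A)\<close>.\<close>

lemma wmeas_half_le:
  assumes "l > 0" "G \<subseteq> hcube a l" and G [measurable]: "G \<in> sets lebesgue"
    and "2 * emeasure lebesgue G \<le> emeasure lebesgue (hcube a l)"
  shows "wmeas \<omega> G \<le> ennreal (1 - 1 / (2 * A)) * wmeas \<omega> (hcube a l)"
proof -
  define s where "s = l ^ CARD('n)"
  have s: "s > 0" "emeasure lebesgue (hcube a l) = ennreal s"
    using assms by (auto simp: s_def emeasure_hcube)
  obtain v where v: "v > 0" "wmeas \<omega> (hcube a l) = ennreal v"
    using wmeas_hcube_real[OF assms(1)] .
  have "emeasure lebesgue G \<le> ennreal s"
    unfolding s(2)[symmetric] using assms by (intro emeasure_mono) auto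
  then obtain u where u: "emeasure lebesgue G = ennreal u" "u \<ge> 0"
    by (cases "emeasure lebesgue G") (auto simp: top_unique)
  have "2 * emeasure lebesgue G = ennreal (2 * u)"
    using u by (simp add: ennreal_mult)
  then have us: "2 * u \<le> s"
    using assms(4) s u by (simp add: ennreal_le_iff)
  have "wmeas \<omega> G \<le> ennreal v"
    unfolding v(2)[symmetric] using assms(2) by (intro wmeas_mono_AE) auto
  then obtain w where w: "wmeas \<omega> G = ennreal w" "w \<ge> 0"
    by (cases "wmeas \<omega> G") (auto simp: top_unique)
  have "wmeas \<omega> (hcube a l - G) \<le> ennreal v"
    unfolding v(2)[symmetric] using assms(2) by (intro wmeas_mono_AE) auto
  then obtain w' where w': "wmeas \<omega> (hcube a l - G) = ennreal w'" "w' \<ge> 0"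
    by (cases "wmeas \<omega> (hcube a l - G)") (auto simp: top_unique)
  have "wmeas \<omega> (hcube a l) = wmeas \<omega> G + wmeas \<omega> (hcube a l - G)"
    using plus_emeasure[of G "density lebesgue (\<lambda>x. ennreal (\<omega> x))" "hcube a l - G"] assms
    by (simp add: wmeas_eq_emeasure Un_absorb1)
  then have sum: "v = w + w'"
    using v w w' by (simp flip: ennreal_plus)
  have c: "v / (A * s) \<ge> 0"
    using v s A_ge_1 by simp
  have "emeasure lebesgue (hcube a l - G) = ennreal s - ennreal u"
    using assms u s by (subst emeasure_Diff) auto
  then have "emeasure lebesgue (hcube a l - G) = ennreal (s - u)"
    using u by (simp add: ennreal_minus)
  then have "ennreal (v / (A * s) * (s - u)) = (\<integral>\<^sup>+x\<in>hcube a l - G. ennreal (v / (A * s)) \<partial>lebesgue)"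
    using c us u by (simp add: nn_integral_cmult_indicator ennreal_mult[OF c] del: times_divide_eq_left)
  also have "\<dots> \<le> (\<integral>\<^sup>+x\<in>hcube a l - G. ennreal (\<omega> x) \<partial>lebesgue)"
    using wmeas_le_A_real[OF assms(1) v(2,1)] s A_ge_1
    by (intro nn_integral_mono_AE)
      (auto elim!: eventually_mono simp: indicator_def field_simps s_def intro!: ennreal_leI)
  also have "\<dots> = ennreal w'"
    using w' by (simp add: wmeas_def)
  finally have w'_ge: "v / (A * s) * (s - u) \<le> w'"
    using w' by (simp add: ennreal_le_iff)
  have "v / (2 * A) = v / (A * s) * (s / 2)"
    using s by simp
  also have "\<dots> \<le> v / (A * s) * (s - u)"
    using us c by (intro mult_left_mono) auto
  finally have "w \<le> (1 - 1 / (2 * A)) * v"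
    using w'_ge sum by (simp add: left_diff_distrib)
  then show ?thesis
    using w v A_ge_1 by (simp add: ennreal_leI flip: ennreal_mult)
qed

text \<open>Induction on \<open>k\<close>, with the cube arbitrary because the hypothesis is applied
  to stopping cubes. Each step lowers the threshold by \<open>c * \<omega>\<close>, the cost of
  changing the average, and gains one factor \<open>1 - 1 / (2 * A)\<close> from
  \<open>wmeas_half_le\<close>.\<close>

lemma oscillation_decay:
  fixes f :: "real ^ 'n \<Rightarrow> 'b :: {banach, second_countable_topology}"
  assumes f: "locally_integrable f" and "B > 0"
    and osc: "\<And>a l. l > 0 \<Longrightarrow>
      (\<integral>\<^sup>+x\<in>hcube a l. norm (f x - avg (hcube a l) f) \<partial>lebesgue) \<le> ennreal B * wmeas \<omega> (hcube a l)"
    and "l > 0"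
  shows "wmeas \<omega> {x \<in> hcube a l. real k * (2 * 2 ^ CARD('n) * A * B) * \<omega> x < norm (f x - avg (hcube a l) f)}
    \<le> ennreal (1 - 1 / (2 * A)) ^ k * wmeas \<omega> (hcube a l)"
  using \<open>l > 0\<close>
proof (induction k arbitrary: a l)
  case 0
  have "wmeas \<omega> {x \<in> hcube a l. real 0 * (2 * 2 ^ CARD('n) * A * B) * \<omega> x < norm (f x - avg (hcube a l) f)}
      \<le> wmeas \<omega> (hcube a l)"
    by (rule wmeas_mono_AE) simp
  then show ?case
    by simp
next
  case (Suc k)
  have [measurable]: "f \<in> borel_measurable lebesgue"
    using f by (rule borel_measurable_locally_integrable)
  define c where "c = 2 * 2 ^ CARD('n) * A * B"
  define m where "m = avg (hcube a l) f"
  define E where "E j H = {x \<in> H. real j * c * \<omega> x < norm (f x - avg H f)}" for j H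
  have E [measurable]: "E j H \<in> sets lebesgue" if "H \<in> sets lebesgue" for j H
    using that unfolding E_def by measurable
  define s where "s = l ^ CARD('n)"
  have s: "s > 0" "emeasure lebesgue (hcube a l) = ennreal s"
    using Suc.prems by (auto simp: s_def emeasure_hcube)
  obtain v where v: "v > 0" "wmeas \<omega> (hcube a l) = ennreal v"
    using wmeas_hcube_real[OF Suc.prems] .
  \<comment> \<open>Twice the bound \<open>B * v / s\<close> on the mean oscillation; the factor 2
    limits the stopping cubes to half of the volume.\<close>
  define L where "L = 2 * B * v / s"
  have L: "L > 0"
    using s v \<open>B > 0\<close> by (simp add: L_def)
  have osc_m: "(\<integral>\<^sup>+x\<in>hcube a l. norm (f x - m) \<partial>lebesgue) \<le> ennreal (B * v)"
    using osc[OF Suc.prems, of a] v \<open>B > 0\<close> by (simp add: m_def ennreal_mult)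
  also have "\<dots> \<le> ennreal (L * s)"
    using s v \<open>B > 0\<close> by (intro ennreal_leI) (simp add: L_def)
  also have "\<dots> = ennreal L * emeasure lebesgue (hcube a l)"
    using L s by (simp add: ennreal_mult)
  finally have top: "(\<integral>\<^sup>+x\<in>hcube a l. norm (f x - m) \<partial>lebesgue) \<le> ennreal L * emeasure lebesgue (hcube a l)" .
  obtain F where F: "countable F" "disjoint F" "\<And>H. H \<in> F \<Longrightarrow> H \<subseteq> hcube a l"
    "\<And>H. H \<in> F \<Longrightarrow> \<exists>b r. r > 0 \<and> H = hcube b r"
    "\<And>H. H \<in> F \<Longrightarrow> L * emeasure lebesgue H \<le> (\<integral>\<^sup>+y\<in>H. norm (f y - m) \<partial>lebesgue)"
    "\<And>H. H \<in> F \<Longrightarrow> (\<integral>\<^sup>+y\<in>H. norm (f y - m) \<partial>lebesgue) \<le> 2 ^ CARD('n) * (L * emeasure lebesgue H)"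
    "AE x in lebesgue. x \<in> hcube a l - \<Union>F \<longrightarrow> ennreal (norm (f x - m)) \<le> L"
    by (rule calderon_zygmund[OF _ Suc.prems less_imp_le[OF L] top]) auto
  have sets: "H \<in> sets lebesgue" if "H \<in> F" for H
    using F(4)[OF that] by auto
  then have UF [measurable]: "\<Union>F \<in> sets lebesgue"
    using F by (intro sets.countable_Union) auto
  have UF_sub: "\<Union>F \<subseteq> hcube a l"
    using F(3) by blast

  \<comment> \<open>The integral of \<open>norm (f x - m)\<close> over each stopping cube is at
    least \<open>L\<close> times its volume. Summation gives
    \<open>L |\<Union>F| \<le> B v = L s / 2\<close>.\<close>
  have "ennreal L * emeasure lebesgue (\<Union>F) = emeasure (density lebesgue (\<lambda>_. ennreal L)) (\<Union>F)"
    by (simp add: emeasure_density_const)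
  also have "\<dots> \<le> 1 * emeasure (density lebesgue (\<lambda>x. ennreal (norm (f x - m)))) (\<Union>F)"
  proof (rule emeasure_Union_mono_mult[OF F(1,2)])
    show "emeasure (density lebesgue (\<lambda>_. ennreal L)) H
        \<le> 1 * emeasure (density lebesgue (\<lambda>x. ennreal (norm (f x - m)))) H" if "H \<in> F" for H
      using F(5)[OF that] sets[OF that]
      by (subst emeasure_density_const, simp, subst emeasure_density) auto
  qed (use sets in auto)
  also have "\<dots> \<le> (\<integral>\<^sup>+x\<in>hcube a l. norm (f x - m) \<partial>lebesgue)"
    using nn_set_integral_set_mono[OF UF_sub] UF by (subst mult_1_left, subst emeasure_density) simp_all
  also have "\<dots> \<le> ennreal (B * v)"
    by (rule osc_m)
  finally have *: "ennreal L * emeasure lebesgue (\<Union>F) \<le> ennreal (B * v)" .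
  have "emeasure lebesgue (\<Union>F) \<le> ennreal s"
    unfolding s(2)[symmetric] by (rule emeasure_mono[OF UF_sub]) simp
  then obtain u where u: "emeasure lebesgue (\<Union>F) = ennreal u" "u \<ge> 0"
    by (cases "emeasure lebesgue (\<Union>F)") (simp_all add: top_unique)
  have "L * u \<le> B * v"
    using * u L v \<open>B > 0\<close> by (simp add: ennreal_le_iff flip: ennreal_mult)
  then have "2 * u \<le> s"
    using s v \<open>B > 0\<close> by (simp add: L_def field_simps)
  then have "2 * emeasure lebesgue (\<Union>F) \<le> emeasure lebesgue (hcube a l)"
    using u s ennreal_leI[of "2 * u" s] by (simp add: ennreal_mult)
  then have small: "wmeas \<omega> (\<Union>F) \<le> ennreal (1 - 1 / (2 * A)) * wmeas \<omega> (hcube a l)"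
    by (rule wmeas_half_le[OF Suc.prems UF_sub UF])

  \<comment> \<open>The upper Calderon--Zygmund bound, divided by the volume of
    \<open>H\<close>.\<close>
  have avg_F: "norm (avg H f - m) \<le> 2 ^ CARD('n) * L" if H: "H \<in> F" for H
  proof -
    obtain b r where b: "r > 0" "H = hcube b r"
      using F(4)[OF H] by blast
    have "ennreal (r ^ CARD('n)) * norm (avg H f - m) \<le> 2 ^ CARD('n) * (L * ennreal (r ^ CARD('n)))"
      using norm_avg_diff_le[OF f b(1), of b m] F(6)[OF H] b by (auto simp: emeasure_hcube)
    also have "\<dots> = ennreal (2 ^ CARD('n) * (L * r ^ CARD('n)))"
      using L b(1) by (simp add: ennreal_mult flip: ennreal_power)
    finally have "r ^ CARD('n) * norm (avg H f - m) \<le> 2 ^ CARD('n) * (L * r ^ CARD('n))"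
      using L b(1) by (simp add: ennreal_le_iff flip: ennreal_mult)
    then show ?thesis
      using b(1) by (simp add: field_simps)
  qed
  \<comment> \<open>Here the value of \<open>c\<close> comes in:
    \<open>v \<le> A * s * \<omega> x\<close> turns \<open>2 ^ n * L\<close> into at most
    \<open>c * \<omega> x\<close>. Since \<open>norm (f x - m)\<close> exceeds
    \<open>c * \<omega> x\<close> and hence \<open>L\<close>, the point lies in a stopping cube
    \<open>H\<close>, and replacing \<open>m\<close> by the average over \<open>H\<close> costs at
    most \<open>c * \<omega> x\<close>.\<close>
  have cov: "AE x in lebesgue. x \<in> E (Suc k) (hcube a l) \<longrightarrow> x \<in> (\<Union>H\<in>F. E k H)"
    using wmeas_le_A_real[OF Suc.prems v(2,1)] F(7)
  proof eventually_elim
    case (elim x)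
    show ?case
    proof
      assume x: "x \<in> E (Suc k) (hcube a l)"
      then have xH: "x \<in> hcube a l"
        by (simp add: E_def)
      have large: "real k * c * \<omega> x + c * \<omega> x < norm (f x - m)"
        using x by (simp add: E_def m_def algebra_simps)
      have "v \<le> A * s * \<omega> x"
        using elim(1) xH by (simp add: s_def)
      then have "2 ^ CARD('n) * L \<le> c * \<omega> x"
        using s \<open>B > 0\<close> by (simp add: L_def c_def field_simps)
      moreover have "L \<le> 2 ^ CARD('n) * L"
        using L by simp
      moreover have "0 \<le> real k * c * \<omega> x"
        using A_ge_1 \<open>B > 0\<close> nonneg[of x] by (simp add: c_def)
      ultimately have "\<not> norm (f x - m) \<le> L" and L_le: "2 ^ CARD('n) * L \<le> c * \<omega> x"
        using large by linarith+
      then have "x \<in> \<Union>F"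
        using elim(2) xH L by auto
      then obtain H where H: "H \<in> F" "x \<in> H"
        by blast
      have "norm (f x - m) \<le> norm (f x - avg H f) + norm (avg H f - m)"
        using norm_triangle_ineq[of "f x - avg H f" "avg H f - m"] by simp
      then have "real k * c * \<omega> x < norm (f x - avg H f)"
        using large L_le avg_F[OF H(1)] by linarith
      then show "x \<in> (\<Union>H\<in>F. E k H)"
        using H by (auto simp: E_def)
    qed
  qed
  \<comment> \<open>The induction hypothesis on the disjoint stopping cubes gives the
    \<open>k\<close>-th power relative to \<open>\<Union>F\<close>, and \<open>small\<close>
    supplies one more factor.\<close>
  have "wmeas \<omega> (E (Suc k) (hcube a l)) \<le> wmeas \<omega> (\<Union>H\<in>F. E k H)"
    using cov by (rule wmeas_mono_AE)
  also have "\<dots> = emeasure (density lebesgue (\<lambda>x. ennreal (\<omega> x))) (\<Union>H\<in>F. E k H)"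
  proof (rule wmeas_eq_emeasure[OF meas])
    show "(\<Union>H\<in>F. E k H) \<in> sets lebesgue"
      by (intro sets.countable_UN''[OF F(1)] E sets)
  qed
  also have "\<dots> \<le> ennreal (1 - 1 / (2 * A)) ^ k * emeasure (density lebesgue (\<lambda>x. ennreal (\<omega> x))) (\<Union>F)"
  proof (rule emeasure_UN_mono_mult[OF F(1,2)])
    fix H assume H: "H \<in> F"
    then obtain b r where b: "r > 0" "H = hcube b r"
      using F(4) by blast
    show "emeasure (density lebesgue (\<lambda>x. ennreal (\<omega> x))) (E k H)
        \<le> ennreal (1 - 1 / (2 * A)) ^ k * emeasure (density lebesgue (\<lambda>x. ennreal (\<omega> x))) H"
      using Suc.IH[OF b(1), of b]
      unfolding c_def[symmetric] b(2)[symmetric] E_def[symmetric]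
        wmeas_eq_emeasure[OF meas sets[OF H]] wmeas_eq_emeasure[OF meas E[OF sets[OF H]]] .
    show "E k H \<in> sets (density lebesgue (\<lambda>x. ennreal (\<omega> x)))"
      "H \<in> sets (density lebesgue (\<lambda>x. ennreal (\<omega> x)))"
      using sets[OF H] E[OF sets[OF H]] by simp_all
    show "E k H \<subseteq> H"
      unfolding E_def by (rule Collect_restrict)
  qed
  also have "\<dots> \<le> ennreal (1 - 1 / (2 * A)) ^ k * (ennreal (1 - 1 / (2 * A)) * wmeas \<omega> (hcube a l))"
    using small unfolding wmeas_eq_emeasure[OF meas UF] by (intro mult_left_mono) simp_all
  finally show ?case
    unfolding E_def c_def m_def power_Suc by (simp add: mult.assoc mult.left_commute)
qed

end

section \<open>Comparison of the norms\<close>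

lemma set_nn_integral_cbox_cube:
  "(\<integral>\<^sup>+x\<in>cbox a (a + vec l). g x \<partial>lebesgue) = (\<integral>\<^sup>+x\<in>hcube a l. g x \<partial>lebesgue)"
proof (rule nn_integral_cong_AE)
  show "AE x in lebesgue. g x * indicator (cbox a (a + vec l)) x = g x * indicator (hcube a l) x"
    using AE_hcube_cbox[of a l] by eventually_elim (simp add: indicator_def)
qed

lemma wmeas_cbox_cube: "wmeas \<omega> (cbox a (a + vec l)) = wmeas \<omega> (hcube a l)"
  unfolding wmeas_def by (rule set_nn_integral_cbox_cube)

lemma ennreal_le_of_divide_le:
  assumes "x / ennreal v \<le> b" "v > 0"
  shows "x \<le> b * ennreal v"
proof -
  have "x = x / ennreal v * ennreal v"
    using assms by (simp add: ennreal_divide_times)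
  also have "\<dots> \<le> b * ennreal v"
    using assms by (intro mult_right_mono) auto
  finally show ?thesis .
qed

text \<open>The almost everywhere bound unfolds the essential supremum on one closed cube.
  Positivity on every cube uses that a weight is not almost everywhere zero.\<close>

lemma A1_weight_exists:
  fixes \<omega> :: "real ^ 'n \<Rightarrow> real"
  assumes "\<omega> \<in> A1"
  shows "\<exists>A. A1_weight \<omega> A"
proof -
  have nonneg: "0 \<le> \<omega> x" for x
    using assms by (simp add: A1_def weight_def)
  have loc: "locally_integrable \<omega>" and nz: "\<not> (AE x in lebesgue. \<omega> x = 0)"
    and fin: "A1_const \<omega> < \<infinity>"
    using assms by (auto simp: A1_def weight_def)
  have meas [measurable]: "\<omega> \<in> borel_measurable lebesgue"
    using loc by (rule borel_measurable_locally_integrable)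
  define A where "A = max 1 (enn2real (A1_const \<omega>))"
  have "A1_const \<omega> = ennreal (enn2real (A1_const \<omega>))"
    using fin by simp
  also have "\<dots> \<le> ennreal A"
    by (rule ennreal_leI) (simp add: A_def)
  finally have A: "A1_const \<omega> \<le> ennreal A" .
  have A_ge_1: "A \<ge> 1"
    by (simp add: A_def)
  have wfin: "wmeas \<omega> (hcube a l) < \<infinity>" for a l
  proof -
    have "integrable lebesgue (\<lambda>x. indicator (hcube a l) x *\<^sub>R \<omega> x)"
      using set_integrable_hcube[OF loc] unfolding set_integrable_def .
    then have "(\<integral>\<^sup>+x. norm (indicator (hcube a l) x *\<^sub>R \<omega> x) \<partial>lebesgue) < \<infinity>"
      unfolding integrable_iff_bounded by simp
    also have "(\<integral>\<^sup>+x. norm (indicator (hcube a l) x *\<^sub>R \<omega> x) \<partial>lebesgue) = wmeas \<omega> (hcube a l)"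
      unfolding wmeas_def using nonneg by (intro nn_integral_cong) (simp split: split_indicator)
    finally show ?thesis .
  qed
  have le: "AE x in lebesgue. x \<in> hcube a l \<longrightarrow>
      wmeas \<omega> (hcube a l) \<le> ennreal A * emeasure lebesgue (hcube a l) * \<omega> x" if l: "l > 0" for a l
  proof -
    define Q where "Q = cbox a (a + vec l)"
    define v where "v = enn2real (wmeas \<omega> (hcube a l))"
    define s where "s = l ^ CARD('n)"
    have v: "wmeas \<omega> (hcube a l) = ennreal v" "v \<ge> 0"
      using wfin[of a l] by (simp_all add: v_def)
    have s: "emeasure lebesgue (hcube a l) = ennreal s" "s > 0"
      using l by (simp_all add: s_def emeasure_hcube)
    have "Q \<in> cubes"
      using l by (auto simp: cubes_def Q_def)
    then have "wmeas \<omega> Q / emeasure lebesgue Q * esssup (lebesgue_on Q) (\<lambda>x. inverse (ennreal (\<omega> x))) \<le> A1_const \<omega>"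
      unfolding A1_const_def by (rule SUP_upper)
    also note A
    finally have le_A: "ennreal (v / s) * esssup (lebesgue_on Q) (\<lambda>x. inverse (ennreal (\<omega> x))) \<le> ennreal A"
      using v s by (simp add: Q_def wmeas_cbox_cube emeasure_cbox_cube divide_ennreal)
    have "AE x in lebesgue_on Q. inverse (ennreal (\<omega> x)) \<le> esssup (lebesgue_on Q) (\<lambda>x. inverse (ennreal (\<omega> x)))"
      by (rule esssup_AE)
    then have "AE x in lebesgue. x \<in> Q \<longrightarrow>
        inverse (ennreal (\<omega> x)) \<le> esssup (lebesgue_on Q) (\<lambda>x. inverse (ennreal (\<omega> x)))"
      by (subst (asm) AE_restrict_space_iff) (simp_all add: Q_def)
    then show ?thesis
    proof eventually_elim
      case (elim x)
      show ?case
      proof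
        assume "x \<in> hcube a l"
        then have "x \<in> Q"
          using hcube_subset_cbox Q_def by blast
        then have "ennreal (v / s) * inverse (ennreal (\<omega> x)) \<le> ennreal A"
          using elim le_A by (meson order_trans mult_left_mono zero_le)
        then have "v \<le> A * s * \<omega> x"
        proof (cases "\<omega> x = 0")
          \<comment> \<open>In \<open>ennreal\<close> the inverse of 0 is infinite, so the finite
            bound forces \<open>v = 0\<close>.\<close>
          case True
          then show ?thesis
            using \<open>ennreal (v / s) * inverse (ennreal (\<omega> x)) \<le> ennreal A\<close> v s
            by (cases "v = 0") (simp_all add: ennreal_mult_top top_unique)
        next
          case False
          then have pos: "\<omega> x > 0"
            using nonneg[of x] by simp
          then have "ennreal (v / s * inverse (\<omega> x)) \<le> ennreal A"
            using \<open>ennreal (v / s) * inverse (ennreal (\<omega> x)) \<le> ennreal A\<close> v s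
            by (subst ennreal_mult) (simp_all add: inverse_ennreal)
          then have "v / s * inverse (\<omega> x) \<le> A"
            using A_ge_1 by (simp add: ennreal_le_iff)
          then show ?thesis
            using pos s by (simp add: field_simps)
        qed
        then have "ennreal v \<le> ennreal (A * s * \<omega> x)"
          by (rule ennreal_leI)
        also have "\<dots> = ennreal A * ennreal s * ennreal (\<omega> x)"
          using A_ge_1 s nonneg[of x] by (simp add: ennreal_mult)
        finally show "wmeas \<omega> (hcube a l) \<le> ennreal A * emeasure lebesgue (hcube a l) * \<omega> x"
          by (simp add: v s)
      qed
    qed
  qed
  \<comment> \<open>If \<open>\<omega>\<close> had zero mass on one cube, the \<open>A1\<close>
    bound on ever larger cubes around it would make \<open>\<omega>\<close> vanish almost
    everywhere.\<close>
  have pos: "wmeas \<omega> (hcube a l) > 0" if l: "l > 0" for a l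
  proof (rule ccontr)
    assume "\<not> wmeas \<omega> (hcube a l) > 0"
    then have "(\<integral>\<^sup>+x. ennreal (\<omega> x) * indicator (hcube a l) x \<partial>lebesgue) = 0"
      by (simp add: wmeas_def)
    then have null: "AE x in lebesgue. ennreal (\<omega> x) * indicator (hcube a l) x = 0"
      by (subst (asm) nn_integral_0_iff_AE) auto
    have "AE x in lebesgue. x \<in> hcube (a - vec (real N)) (l + 2 * real N) \<longrightarrow> \<omega> x = 0" for N
    proof -
      let ?H = "hcube (a - vec (real N)) (l + 2 * real N)"
      have sub: "hcube a l \<subseteq> ?H"
        unfolding hcube_def
      proof (intro Collect_mono impI allI)
        fix x i assume "\<forall>i. a $ i \<le> x $ i \<and> x $ i < a $ i + l"
        then have "a $ i \<le> x $ i" "x $ i < a $ i + l"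
          by blast+
        then show "(a - vec (real N)) $ i \<le> x $ i \<and> x $ i < (a - vec (real N)) $ i + (l + 2 * real N)"
          by simp
      qed
      have lN: "l + 2 * real N > 0"
        using l by simp
      have "wmeas \<omega> ?H = 0"
      proof (rule ccontr)
        assume "wmeas \<omega> ?H \<noteq> 0"
        \<comment> \<open>Where \<open>\<omega> x = 0\<close>, the bound on \<open>?H\<close> would
          give \<open>wmeas \<omega> ?H = 0\<close>. So almost no point lies in
          \<open>hcube a l\<close>, which contradicts its positive volume.\<close>
        have "AE x in lebesgue. x \<notin> hcube a l"
          using null le[OF lN, of "a - vec (real N)"]
        proof eventually_elim
          case (elim x)
          show ?case
          proof
            assume "x \<in> hcube a l"
            then have "ennreal (\<omega> x) = 0" "wmeas \<omega> ?H \<le> ennreal A * emeasure lebesgue ?H * \<omega> x"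
              using elim sub by auto
            then show False
              using \<open>wmeas \<omega> ?H \<noteq> 0\<close> by simp
          qed
        qed
        then have "emeasure lebesgue (hcube a l) = 0"
          by (simp add: AE_iff_measurable[of "hcube a l"])
        then show False
          using l by (simp add: emeasure_hcube)
      qed
      then have "(\<integral>\<^sup>+x. ennreal (\<omega> x) * indicator ?H x \<partial>lebesgue) = 0"
        by (simp add: wmeas_def)
      then have "AE x in lebesgue. ennreal (\<omega> x) * indicator ?H x = 0"
        by (subst (asm) nn_integral_0_iff_AE) auto
      then show ?thesis
      proof eventually_elim
        case (elim x)
        then show ?case
          using nonneg[of x] by (simp split: split_indicator_asm)
      qed
    qed
    then have "AE x in lebesgue. \<forall>N::nat. x \<in> hcube (a - vec (real N)) (l + 2 * real N) \<longrightarrow> \<omega> x = 0"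
      unfolding AE_all_countable by blast
    then have "AE x in lebesgue. \<omega> x = 0"
    proof eventually_elim
      case (elim x)
      obtain N where N: "norm (x - a) \<le> real N"
        using real_arch_simple by blast
      have "\<bar>x $ i - a $ i\<bar> \<le> real N" for i
        using component_le_norm_cart[of "x - a" i] N by simp
      then have "x \<in> hcube (a - vec (real N)) (l + 2 * real N)"
        unfolding hcube_def mem_Collect_eq
      proof (intro allI)
        fix i
        show "(a - vec (real N)) $ i \<le> x $ i \<and> x $ i < (a - vec (real N)) $ i + (l + 2 * real N)"
          using \<open>\<And>i. \<bar>x $ i - a $ i\<bar> \<le> real N\<close>[of i] l by (simp add: abs_le_iff)
      qed
      then show ?case
        using elim by blast
    qed
    then show False
      using nz by blast
  qed
  have "A1_weight \<omega> A"
    by unfold_locales (rule nonneg meas A_ge_1 wfin pos le; assumption?)+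
  then show ?thesis ..
qed

section \<open>Powers, elementary estimates and the weak norm of an indicator\<close>

lemma epowr_ennreal: "0 \<le> v \<Longrightarrow> epowr (ennreal v) a = ennreal (v powr a)"
  by (simp add: epowr_def)

lemma epowr_mono:
  assumes "x \<le> y" "0 \<le> a"
  shows "epowr x a \<le> epowr y a"
proof (cases "y = \<infinity>")
  case False
  then have "x < \<infinity>" "enn2real x \<le> enn2real y"
    using assms by (auto simp: less_top top_unique intro!: enn2real_mono)
  then show ?thesis
    using False assms by (auto simp: epowr_def intro!: ennreal_leI powr_mono2)
qed (simp add: epowr_def)

text \<open>The left side is a sum of \<open>k + 1\<close> copies of \<open>r ^ k\<close>, each at
  most a distinct term of the geometric series.\<close>

lemma Suc_mult_power_le:
  fixes r :: real
  assumes "0 \<le> r" "r < 1"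
  shows "real (Suc k) * r ^ k \<le> 1 / (1 - r)"
proof -
  have "real (Suc k) * r ^ k = (\<Sum>i<Suc k. r ^ k)"
    by simp
  also have "\<dots> \<le> (\<Sum>i<Suc k. r ^ i)"
    using assms by (intro sum_mono power_decreasing) auto
  also have "\<dots> \<le> (\<Sum>i. r ^ i)"
    using assms by (intro sum_le_suminf summable_geometric) auto
  also have "\<dots> = 1 / (1 - r)"
    using assms by (intro suminf_geometric) auto
  finally show ?thesis .
qed

text \<open>Reduces a norm inequality to positive finite bounds \<open>N\<close>, as the estimates
  below require. A norm equal to 0 is reached by letting \<open>N\<close> decrease, and an infinite
  one is trivial.\<close>

lemma ennreal_le_multI:
  fixes C :: real
  assumes "C > 0" "\<And>N::real. N > 0 \<Longrightarrow> u \<le> ennreal N \<Longrightarrow> v \<le> ennreal (C * N)"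
  shows "v \<le> ennreal C * u"
proof (cases u)
  case (real b)
  show ?thesis
  proof (rule ennreal_le_epsilon)
    fix e :: real assume e: "e > 0"
    have "v \<le> ennreal (C * (b + e / C))"
      by (rule assms(2)) (use real assms(1) e in \<open>auto intro!: add_nonneg_pos ennreal_leI\<close>)
    also have "C * (b + e / C) = C * b + e"
      using assms(1) by (simp add: field_simps)
    finally show "v \<le> ennreal C * u + ennreal e"
      using real assms(1) e by (simp add: ennreal_mult)
  qed
qed (use assms in \<open>simp add: ennreal_mult_top\<close>)

lemma exists_dyadic_level:
  fixes N y :: real
  assumes "0 < N" "N < y"
  obtains k where "2 ^ k * N < y" "y \<le> 2 ^ Suc k * N"
proof -
  have ex: "\<exists>k. y \<le> 2 ^ Suc k * N"
  proof -
    obtain k where "y / N < 2 ^ k"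
      using real_arch_pow[of 2 "y / N"] by auto
    then have "y \<le> 2 ^ Suc k * N"
      using assms by (simp add: field_simps)
    then show ?thesis ..
  qed
  define k where "k = (LEAST k. y \<le> 2 ^ Suc k * N)"
  have "y \<le> 2 ^ Suc k * N"
    unfolding k_def by (rule LeastI_ex[OF ex])
  moreover have "2 ^ k * N < y"
  proof (cases k)
    case (Suc j)
    then have "\<not> y \<le> 2 ^ Suc j * N"
      using not_less_Least[of j "\<lambda>k. y \<le> 2 ^ Suc k * N"] by (simp add: k_def)
    then show ?thesis
      using Suc by simp
  qed (use assms in simp)
  ultimately show ?thesis
    using that by blast
qed

text \<open>Superlevel sets are \<open>Q\<close> for \<open>t < 1\<close> and empty otherwise. The
  lower bound takes the single value \<open>t = 1 / 2\<close>, so a factor 2 replaces the limit of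
  \<open>t\<close> to 1.\<close>

lemma weak_Lp_norm_indicator_bounds:
  fixes Q :: "(real ^ 'n) set"
  assumes "wmeas \<omega> Q = ennreal v" "v > 0" "p > 0"
  obtains c where "weak_Lp_norm p \<omega> (indicator Q :: _ \<Rightarrow> 'b::{real_normed_field}) = ennreal c"
    "c \<le> v powr (1 / p)" "v powr (1 / p) \<le> 2 * c"
proof -
  have ind: "{x. norm (indicator Q x :: 'b) > t} = (if t < 1 then Q else {})" if "t > 0" for t
    using that by (auto simp: indicator_def split: if_splits)
  have V: "epowr (wmeas \<omega> Q) (1 / p) = ennreal (v powr (1 / p))"
    using assms by (simp add: epowr_ennreal)
  have le: "weak_Lp_norm p \<omega> (indicator Q :: _ \<Rightarrow> 'b) \<le> ennreal (v powr (1 / p))"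
    unfolding weak_Lp_norm_def
  proof (rule SUP_least)
    fix t :: real assume "t \<in> {0<..}"
    then have t: "t > 0" by simp
    show "ennreal t * epowr (wmeas \<omega> {x. t < norm (indicator Q x :: 'b)}) (1 / p) \<le> ennreal (v powr (1 / p))"
    proof (cases "t < 1")
      case True
      then have "ennreal t * ennreal (v powr (1 / p)) \<le> 1 * ennreal (v powr (1 / p))"
        using t by (intro mult_right_mono) auto
      then show ?thesis
        using True t by (simp add: ind V)
    next
      case False
      then show ?thesis
        using t by (simp add: ind wmeas_def epowr_def)
    qed
  qed
  have "ennreal (1 / 2) * epowr (wmeas \<omega> {x. 1 / 2 < norm (indicator Q x :: 'b)}) (1 / p)
      \<le> weak_Lp_norm p \<omega> (indicator Q :: _ \<Rightarrow> 'b)"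
    unfolding weak_Lp_norm_def by (rule SUP_upper) simp
  then have ge: "ennreal (1 / 2 * v powr (1 / p)) \<le> weak_Lp_norm p \<omega> (indicator Q :: _ \<Rightarrow> 'b)"
    unfolding ind[OF half_gt_zero[OF zero_less_one]] by (subst ennreal_mult) (simp_all add: V)
  obtain c where c: "weak_Lp_norm p \<omega> (indicator Q :: _ \<Rightarrow> 'b) = ennreal c" "c \<ge> 0"
    using le by (cases "weak_Lp_norm p \<omega> (indicator Q :: _ \<Rightarrow> 'b)") (simp_all add: top_unique)
  show ?thesis
    by (rule that[OF c(1)]) (use le ge c(2) in \<open>simp_all add: c(1) ennreal_le_iff\<close>)
qed

section \<open>The two inequalities between the norms\<close>

context A1_weight
begin

lemma norm_oscillation_quotient:
  fixes f :: "real ^ 'n \<Rightarrow> 'b::real_normed_field"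
  shows "norm ((f x - m) * indicator Q x / of_real (\<omega> x)) = norm (f x - m) * indicator Q x / \<omega> x"
  using nonneg[of x] by (simp add: norm_divide norm_mult split: split_indicator)

text \<open>For \<open>t\<close> between \<open>k * c\<close> and \<open>(k + 1) * c\<close>, the
  decay estimate bounds the weak norm term by \<open>(k + 1) * c * r ^ k * V\<close>. This is
  bounded uniformly in \<open>k\<close> by \<open>Suc_mult_power_le\<close>.\<close>

lemma BMO_X_norm_le:
  fixes f :: "real ^ 'n \<Rightarrow> 'b :: {real_normed_field, banach, second_countable_topology}"
  assumes f: "locally_integrable f" and "p > 0" and B: "B > 0" and BMO: "BMO_norm \<omega> f \<le> ennreal B"
  shows "BMO_X_norm (weak_Lp_norm p \<omega>) \<omega> f
    \<le> ennreal (4 * 2 ^ CARD('n) * A / (1 - (1 - 1 / (2 * A)) powr (1 / p)) * B)"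
proof -
  define \<eta> where "\<eta> = 1 - 1 / (2 * A)"
  have \<eta>: "0 < \<eta>" "\<eta> < 1"
    using A_ge_1 by (simp_all add: \<eta>_def field_simps)
  define r where "r = \<eta> powr (1 / p)"
  have "r < 1 powr (1 / p)"
    unfolding r_def using \<eta> \<open>p > 0\<close> by (intro powr_less_mono2) auto
  then have r: "0 \<le> r" "r < 1"
    by (simp_all add: r_def)
  define c where "c = 2 * 2 ^ CARD('n) * A * B"
  have c: "c > 0"
    using A_ge_1 B by (simp add: c_def)
  have osc: "(\<integral>\<^sup>+x\<in>hcube a l. norm (f x - avg (hcube a l) f) \<partial>lebesgue) \<le> ennreal B * wmeas \<omega> (hcube a l)"
    if l: "l > 0" for a l
  proof -
    obtain v where v: "v > 0" "wmeas \<omega> (hcube a l) = ennreal v"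
      using wmeas_hcube_real[OF l] .
    have Q: "cbox a (a + vec l) \<in> cubes"
      using l by (auto simp: cubes_def)
    have "(\<integral>\<^sup>+x\<in>cbox a (a + vec l). norm (f x - avg (cbox a (a + vec l)) f) \<partial>lebesgue)
        / wmeas \<omega> (cbox a (a + vec l)) \<le> ennreal B"
      using BMO unfolding BMO_norm_def by (rule order_trans[OF SUP_upper[OF Q]])
    then show ?thesis
      unfolding wmeas_cbox_cube set_nn_integral_cbox_cube avg_hcube_cbox[OF f, symmetric] v(2)
      using v(1) by (rule ennreal_le_of_divide_le)
  qed
  show ?thesis
    unfolding BMO_X_norm_def
  proof (rule SUP_least)
    fix Q :: "(real ^ 'n) set" assume "Q \<in> cubes"
    then obtain a l where l: "l > 0" and Q: "Q = cbox a (a + vec l)"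
      by (auto simp: cubes_def)
    obtain v where v: "v > 0" "wmeas \<omega> (hcube a l) = ennreal v"
      using wmeas_hcube_real[OF l] .
    have vQ: "wmeas \<omega> Q = ennreal v"
      by (simp add: Q wmeas_cbox_cube v)
    define m where "m = avg Q f"
    have m: "avg (hcube a l) f = m"
      by (simp add: m_def Q avg_hcube_cbox[OF f])
    define V where "V = v powr (1 / p)"
    obtain d where d: "weak_Lp_norm p \<omega> (indicator Q :: _ \<Rightarrow> 'b) = ennreal d" "d \<le> V" "V \<le> 2 * d"
      using weak_Lp_norm_indicator_bounds[OF vQ v(1) \<open>p > 0\<close>] unfolding V_def by blast
    have V: "V > 0"
      using v by (simp add: V_def)
    have X: "weak_Lp_norm p \<omega> (\<lambda>x. (f x - m) * indicator Q x / of_real (\<omega> x)) \<le> ennreal (c / (1 - r) * V)"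
      unfolding weak_Lp_norm_def norm_oscillation_quotient
    proof (rule SUP_least)
      fix t :: real assume "t \<in> {0<..}"
      then have t: "t > 0" by simp
      \<comment> \<open>Rounding down enlarges the superlevel set to one covered by the decay
        estimate; \<open>t\<close> itself is at most \<open>(k + 1) * c\<close>.\<close>
      define k where "k = nat \<lfloor>t / c\<rfloor>"
      have "real k \<le> t / c" "t / c \<le> real (Suc k)"
        using t c by (simp_all add: k_def) linarith
      then have k: "real k * c \<le> t" "t \<le> real (Suc k) * c"
        using c by (simp_all add: field_simps)
      have "AE x in lebesgue. x \<in> {x. t < norm (f x - m) * indicator Q x / \<omega> x} \<longrightarrow>
          x \<in> {x \<in> hcube a l. real k * c * \<omega> x < norm (f x - m)}"
        using AE_hcube_cbox[of a l]
      proof eventually_elim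
        case (elim x)
        show ?case
        proof
          assume "x \<in> {x. t < norm (f x - m) * indicator Q x / \<omega> x}"
          then have x: "t < norm (f x - m) * indicator Q x / \<omega> x" by simp
          \<comment> \<open>At a zero of \<open>\<omega>\<close>, division by zero gives the value
            0, which does not exceed \<open>t\<close>.\<close>
          then have "x \<in> Q" "\<omega> x \<noteq> 0"
            using t by (auto split: split_indicator_asm)
          then have "\<omega> x > 0"
            using nonneg[of x] by simp
          then have "t * \<omega> x < norm (f x - m)"
            using x \<open>x \<in> Q\<close> by (simp add: field_simps)
          moreover have "real k * c * \<omega> x \<le> t * \<omega> x"
            using k(1) nonneg by (rule mult_right_mono)
          ultimately show "x \<in> {x \<in> hcube a l. real k * c * \<omega> x < norm (f x - m)}"
            using elim \<open>x \<in> Q\<close> by (simp add: Q)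
        qed
      qed
      then have "wmeas \<omega> {x. t < norm (f x - m) * indicator Q x / \<omega> x}
          \<le> wmeas \<omega> {x \<in> hcube a l. real k * c * \<omega> x < norm (f x - m)}"
        by (rule wmeas_mono_AE)
      also have "\<dots> \<le> ennreal \<eta> ^ k * ennreal v"
        using oscillation_decay[OF f B osc l, of a k] by (simp only: m v \<eta>_def c_def)
      also have "\<dots> = ennreal (\<eta> ^ k * v)"
        using \<eta> v by (simp add: ennreal_mult ennreal_power)
      finally have "epowr (wmeas \<omega> {x. t < norm (f x - m) * indicator Q x / \<omega> x}) (1 / p)
          \<le> epowr (ennreal (\<eta> ^ k * v)) (1 / p)"
        using \<open>p > 0\<close> by (intro epowr_mono) auto
      also have "\<dots> = ennreal ((\<eta> ^ k * v) powr (1 / p))"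
        using \<eta> v by (simp add: epowr_ennreal)
      also have "(\<eta> ^ k * v) powr (1 / p) = r ^ k * V"
      proof -
        have "(\<eta> ^ k) powr (1 / p) = r ^ k"
          using \<eta> by (simp add: r_def powr_powr mult.commute flip: powr_realpow)
        then show ?thesis
          using \<eta> v by (simp add: powr_mult V_def)
      qed
      finally have "ennreal t * epowr (wmeas \<omega> {x. t < norm (f x - m) * indicator Q x / \<omega> x}) (1 / p)
          \<le> ennreal (real (Suc k) * c) * ennreal (r ^ k * V)"
        using k(2) by (intro mult_mono ennreal_leI) auto
      also have "\<dots> = ennreal (real (Suc k) * r ^ k * (c * V))"
        using c V r by (subst ennreal_mult[symmetric]) (auto simp: mult_ac)
      also have "\<dots> \<le> ennreal (1 / (1 - r) * (c * V))"
        using Suc_mult_power_le[OF r, of k] c V by (intro ennreal_leI mult_right_mono) auto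
      finally show "ennreal t * epowr (wmeas \<omega> {x. t < norm (f x - m) * indicator Q x / \<omega> x}) (1 / p)
          \<le> ennreal (c / (1 - r) * V)"
        by simp
    qed
    \<comment> \<open>The norm \<open>d\<close> of the indicator is known only up to a factor 2,
      which turns the 2 in \<open>c\<close> into the 4 of the final constant.\<close>
    have "c / (1 - r) * V \<le> c / (1 - r) * (2 * d)"
      using d(3) c r by (intro mult_left_mono) auto
    then have "ennreal (c / (1 - r) * V) \<le> ennreal d * ennreal (2 * c / (1 - r))"
      using d V c r by (subst ennreal_mult[symmetric]) (auto intro!: ennreal_leI simp: mult_ac)
    with X have "weak_Lp_norm p \<omega> (\<lambda>x. (f x - m) * indicator Q x / of_real (\<omega> x))
        \<le> ennreal d * ennreal (2 * c / (1 - r))"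
      by (rule order_trans)
    then have "weak_Lp_norm p \<omega> (\<lambda>x. (f x - m) * indicator Q x / of_real (\<omega> x)) / ennreal d
        \<le> ennreal (2 * c / (1 - r))"
      using d V by (intro divide_le_posI_ennreal) auto
    also have "2 * c / (1 - r) = 4 * 2 ^ CARD('n) * A / (1 - (1 - 1 / (2 * A)) powr (1 / p)) * B"
      by (simp add: c_def r_def \<eta>_def)
    finally show "weak_Lp_norm p \<omega> (\<lambda>x. (f x - avg Q f) * indicator Q x / of_real (\<omega> x))
        / weak_Lp_norm p \<omega> (indicator Q :: _ \<Rightarrow> 'b)
      \<le> ennreal (4 * 2 ^ CARD('n) * A / (1 - (1 - 1 / (2 * A)) powr (1 / p)) * B)"
      by (simp add: d m_def)
  qed
qed

text \<open>With \<open>h\<close> the quotient by \<open>\<omega>\<close>, the oscillation is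
  \<open>h * \<omega>\<close> almost everywhere on \<open>Q\<close>. The part where
  \<open>h \<le> N\<close> contributes \<open>N * v\<close>, and the layer
  \<open>2 ^ k * N < h \<le> 2 ^ Suc k * N\<close> is controlled by the weak norm.\<close>

lemma BMO_norm_le:
  fixes f :: "real ^ 'n \<Rightarrow> 'b :: {real_normed_field, banach, second_countable_topology}"
  assumes f: "locally_integrable f" and "p > 1" and N: "N > 0"
    and BMO_X: "BMO_X_norm (weak_Lp_norm p \<omega>) \<omega> f \<le> ennreal N"
  shows "BMO_norm \<omega> f \<le> ennreal ((1 + 2 / (1 - 2 powr (1 - p))) * N)"
  unfolding BMO_norm_def
proof (rule SUP_least)
  have [measurable]: "f \<in> borel_measurable lebesgue"
    using f by (rule borel_measurable_locally_integrable)
  fix Q :: "(real ^ 'n) set" assume Q_cube: "Q \<in> cubes"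
  then obtain a l where l: "l > 0" and Q: "Q = cbox a (a + vec l)"
    by (auto simp: cubes_def)
  have [measurable]: "Q \<in> sets lebesgue"
    by (simp add: Q)
  obtain v where v: "v > 0" "wmeas \<omega> (hcube a l) = ennreal v"
    using wmeas_hcube_real[OF l] .
  have vQ: "wmeas \<omega> Q = ennreal v"
    by (simp add: Q wmeas_cbox_cube v)
  define m where "m = avg Q f"
  define h where "h x = norm (f x - m) * indicator Q x / \<omega> x" for x
  have [measurable]: "h \<in> borel_measurable lebesgue"
    unfolding h_def by measurable
  define S where "S t = {x. t < h x}" for t
  have [measurable]: "S t \<in> sets lebesgue" for t
    unfolding S_def using borel_measurable_less[of "\<lambda>_. t" lebesgue h] by simp
  \<comment> \<open>The ratio of the layer sum: each layer doubles the height and divides the mass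
    bound by \<open>2 powr p\<close>. It is below 1 because \<open>p > 1\<close>.\<close>
  define q where "q = 2 powr (1 - p)"
  have q: "0 < q" "q < 1"
    using \<open>p > 1\<close> powr_less_mono[of "1 - p" 0 2] by (simp_all add: q_def)
  define V where "V = v powr (1 / p)"
  have V: "V > 0"
    using v by (simp add: V_def)
  obtain d where d: "weak_Lp_norm p \<omega> (indicator Q :: _ \<Rightarrow> 'b) = ennreal d" "d \<le> V" "V \<le> 2 * d"
    using weak_Lp_norm_indicator_bounds[OF vQ v(1)] \<open>p > 1\<close> unfolding V_def
    by (metis less_trans zero_less_one)
  have "weak_Lp_norm p \<omega> (\<lambda>x. (f x - m) * indicator Q x / of_real (\<omega> x)) / ennreal d \<le> ennreal N"
    using BMO_X unfolding BMO_X_norm_def m_def d(1)[symmetric]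
    by (rule order_trans[OF SUP_upper[OF Q_cube]])
  then have "weak_Lp_norm p \<omega> (\<lambda>x. (f x - m) * indicator Q x / of_real (\<omega> x)) \<le> ennreal N * ennreal d"
    by (rule ennreal_le_of_divide_le) (use d V in simp)
  also have "\<dots> \<le> ennreal N * ennreal V"
    using d(2) by (intro mult_left_mono ennreal_leI) auto
  finally have X: "weak_Lp_norm p \<omega> (\<lambda>x. (f x - m) * indicator Q x / of_real (\<omega> x)) \<le> ennreal (N * V)"
    using N V by (simp add: ennreal_mult)
  have S_le: "wmeas \<omega> (S t) \<le> ennreal ((N / t) powr p * v)" if t: "t > 0" for t
  proof -
    have "ennreal t * epowr (wmeas \<omega> (S t)) (1 / p)
        \<le> weak_Lp_norm p \<omega> (\<lambda>x. (f x - m) * indicator Q x / of_real (\<omega> x))"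
      unfolding weak_Lp_norm_def norm_oscillation_quotient S_def h_def using t by (intro SUP_upper) simp
    then have le: "ennreal t * epowr (wmeas \<omega> (S t)) (1 / p) \<le> ennreal (N * V)"
      using X by (rule order_trans)
    \<comment> \<open>\<open>h\<close> vanishes off \<open>Q\<close>, so this mass is finite and the
      root in \<open>epowr\<close> can be inverted over the reals.\<close>
    have "wmeas \<omega> (S t) \<le> wmeas \<omega> Q"
      using t by (intro wmeas_mono_AE) (simp add: S_def h_def indicator_def)
    then obtain w where w: "wmeas \<omega> (S t) = ennreal w" "w \<ge> 0"
      using vQ by (cases "wmeas \<omega> (S t)") (simp_all add: top_unique)
    have "t * w powr (1 / p) \<le> N * V"
      using le t w N V by (simp add: epowr_ennreal ennreal_le_iff flip: ennreal_mult)
    then have "w powr (1 / p) \<le> N / t * V"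
      using t by (simp add: field_simps)
    then have "(w powr (1 / p)) powr p \<le> (N / t * V) powr p"
      using \<open>p > 1\<close> by (intro powr_mono2) auto
    also have "(N / t * V) powr p = (N / t) powr p * v"
      using N t v \<open>p > 1\<close> by (subst powr_mult) (auto simp: V_def powr_powr)
    finally show ?thesis
      using w \<open>p > 1\<close> by (simp add: powr_powr ennreal_leI)
  qed
  have pointwise: "AE x in lebesgue. ennreal (norm (f x - m)) * indicator Q x
      \<le> ennreal N * (ennreal (\<omega> x) * indicator Q x)
        + (\<Sum>k. ennreal (2 ^ Suc k * N) * (ennreal (\<omega> x) * indicator (S (2 ^ k * N)) x))"
    using wmeas_le_A_real[OF l v(2,1)] AE_hcube_cbox[of a l]
  proof eventually_elim
    case (elim x)
    show ?case
    proof (cases "x \<in> Q")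
      case True
      then have "v \<le> A * l ^ CARD('n) * \<omega> x"
        using elim by (simp add: Q)
      \<comment> \<open>Since \<open>v > 0\<close>, the \<open>A1\<close> bound excludes zeros of
        \<open>\<omega>\<close>, and \<open>f\<close> can be recovered from the quotient.\<close>
      then have "\<omega> x \<noteq> 0"
        using v(1) by auto
      then have pos: "\<omega> x > 0"
        using nonneg[of x] by simp
      have eq: "norm (f x - m) = h x * \<omega> x"
        using True pos by (simp add: h_def)
      show ?thesis
      proof (cases "h x \<le> N")
        case le: True
        have "ennreal (norm (f x - m)) * indicator Q x \<le> ennreal (N * \<omega> x)"
          using True le pos by (simp add: eq ennreal_leI)
        also have "\<dots> = ennreal N * (ennreal (\<omega> x) * indicator Q x)"
          using True N pos by (simp add: ennreal_mult)
        finally show ?thesis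
          by (rule order_trans) simp
      next
        case False
        then obtain k where k: "2 ^ k * N < h x" "h x \<le> 2 ^ Suc k * N"
          using exists_dyadic_level[of N "h x"] N by (metis not_le)
        have "ennreal (norm (f x - m)) * indicator Q x \<le> ennreal (2 ^ Suc k * N * \<omega> x)"
          using True mult_right_mono[OF k(2), of "\<omega> x"] pos by (simp add: eq ennreal_leI)
        also have "\<dots> = ennreal (2 ^ Suc k * N) * (ennreal (\<omega> x) * indicator (S (2 ^ k * N)) x)"
          using k(1) N pos by (simp add: S_def ennreal_mult)
        also have "\<dots> \<le> (\<Sum>k. ennreal (2 ^ Suc k * N) * (ennreal (\<omega> x) * indicator (S (2 ^ k * N)) x))"
          using sum_le_suminf[OF summableI, of "{k}"
              "\<lambda>k. ennreal (2 ^ Suc k * N) * (ennreal (\<omega> x) * indicator (S (2 ^ k * N)) x)"] by simp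
        finally show ?thesis
          by (rule order_trans) simp
      qed
    qed simp
  qed
  have "(\<integral>\<^sup>+x\<in>Q. ennreal (norm (f x - m)) \<partial>lebesgue)
      \<le> (\<integral>\<^sup>+x. ennreal N * (ennreal (\<omega> x) * indicator Q x)
        + (\<Sum>k. ennreal (2 ^ Suc k * N) * (ennreal (\<omega> x) * indicator (S (2 ^ k * N)) x)) \<partial>lebesgue)"
    using pointwise by (rule nn_integral_mono_AE)
  also have "\<dots> = ennreal N * wmeas \<omega> Q + (\<Sum>k. ennreal (2 ^ Suc k * N) * wmeas \<omega> (S (2 ^ k * N)))"
    unfolding wmeas_def by (subst nn_integral_add; simp add: nn_integral_suminf nn_integral_cmult)
  also have "\<dots> \<le> ennreal (N * v) + (\<Sum>k. ennreal (2 * N * v * q ^ k))"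
  proof (intro add_mono suminf_le summableI)
    show "ennreal N * wmeas \<omega> Q \<le> ennreal (N * v)"
      using N v by (simp add: vQ ennreal_mult)
    fix k
    have "ennreal (2 ^ Suc k * N) * wmeas \<omega> (S (2 ^ k * N))
        \<le> ennreal (2 ^ Suc k * N) * ennreal ((N / (2 ^ k * N)) powr p * v)"
      using N by (intro mult_left_mono S_le) auto
    also have "\<dots> = ennreal (2 ^ Suc k * N * ((N / (2 ^ k * N)) powr p * v))"
      using N v by (simp add: ennreal_mult)
    also have "2 ^ Suc k * N * ((N / (2 ^ k * N)) powr p * v) = 2 * N * v * q ^ k"
    proof -
      have "2 ^ k * (1 / 2 ^ k) powr p = q ^ k"
        by (simp add: q_def powr_divide powr_powr powr_diff power_divide mult.commute flip: powr_realpow)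
      then show ?thesis
        using N by (simp add: mult_ac)
    qed
    finally show "ennreal (2 ^ Suc k * N) * wmeas \<omega> (S (2 ^ k * N)) \<le> ennreal (2 * N * v * q ^ k)" .
  qed
  also have "(\<Sum>k. ennreal (2 * N * v * q ^ k)) = ennreal (2 * N * v * (1 / (1 - q)))"
    using N v q by (intro suminf_ennreal_eq sums_mult geometric_sums) auto
  also have "ennreal (N * v) + ennreal (2 * N * v * (1 / (1 - q))) = ennreal v * ennreal ((1 + 2 / (1 - q)) * N)"
    using N v q by (simp add: algebra_simps flip: ennreal_mult ennreal_plus)
  finally show "(\<integral>\<^sup>+x\<in>Q. ennreal (norm (f x - avg Q f)) \<partial>lebesgue) / wmeas \<omega> Q
      \<le> ennreal ((1 + 2 / (1 - 2 powr (1 - p))) * N)"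
    unfolding vQ m_def q_def using v by (intro divide_le_posI_ennreal) auto
qed

end

section \<open>Equality of the spaces and equivalence of the norms\<close>

theorem theorem1p1:
  fixes \<omega> :: "real ^ 'n \<Rightarrow> real" and p :: real
    and X :: "(real ^ 'n \<Rightarrow> 'b::{real_normed_field, banach, second_countable_topology}) \<Rightarrow> ennreal"
  assumes "\<omega> \<in> A1" and "1 < p" and "X = weak_Lp_norm p \<omega>"
  shows "BMO \<omega> = BMO_X X \<omega> \<and>
    (\<exists>C::real. 1 \<le> C \<and> (\<forall>f \<in> BMO \<omega>.
        ennreal (1 / C) * BMO_norm \<omega> f \<le> BMO_X_norm X \<omega> f \<and>
        BMO_X_norm X \<omega> f \<le> ennreal C * BMO_norm \<omega> f))"
proof -
  obtain A where "A1_weight \<omega> A"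
    using A1_weight_exists[OF assms(1)] by blast
  then interpret A1_weight \<omega> A .
  define C1 where "C1 = 1 + 2 / (1 - 2 powr (1 - p))"
  define C2 where "C2 = 4 * 2 ^ CARD('n) * A / (1 - (1 - 1 / (2 * A)) powr (1 / p))"
  define C where "C = max C1 C2"
  have "2 powr (1 - p) < 1"
    using \<open>1 < p\<close> powr_less_mono[of "1 - p" 0 2] by simp
  then have C1: "C1 \<ge> 1"
    by (simp add: C1_def)
  then have C: "C \<ge> 1"
    by (simp add: C_def)
  \<comment> \<open>This estimate and \<open>lower\<close> hold for every locally integrable
    \<open>f\<close>, so finiteness passes between the norms and the two sets coincide.\<close>
  have upper: "BMO_X_norm X \<omega> f \<le> ennreal C * BMO_norm \<omega> f" if f: "locally_integrable f" for f :: "real ^ 'n \<Rightarrow> 'b"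
  proof (rule ennreal_le_multI)
    fix N :: real assume N: "N > 0" "BMO_norm \<omega> f \<le> ennreal N"
    have "BMO_X_norm X \<omega> f \<le> ennreal (C2 * N)"
      unfolding assms(3) C2_def using \<open>1 < p\<close> by (intro BMO_X_norm_le[OF f _ N]) simp
    also have "\<dots> \<le> ennreal (C * N)"
      using N by (intro ennreal_leI mult_right_mono) (auto simp: C_def)
    finally show "BMO_X_norm X \<omega> f \<le> ennreal (C * N)" .
  qed (use C in simp)
  have lower: "BMO_norm \<omega> f \<le> ennreal C * BMO_X_norm X \<omega> f" if f: "locally_integrable f" for f :: "real ^ 'n \<Rightarrow> 'b"
  proof (rule ennreal_le_multI)
    fix N :: real assume N: "N > 0" "BMO_X_norm X \<omega> f \<le> ennreal N"
    have "BMO_norm \<omega> f \<le> ennreal (C1 * N)"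
      unfolding C1_def using N \<open>1 < p\<close> by (intro BMO_norm_le[OF f]) (auto simp: assms(3))
    also have "\<dots> \<le> ennreal (C * N)"
      using N by (intro ennreal_leI mult_right_mono) (auto simp: C_def)
    finally show "BMO_norm \<omega> f \<le> ennreal (C * N)" .
  qed (use C in simp)
  have "BMO_norm \<omega> f < \<infinity> \<longleftrightarrow> BMO_X_norm X \<omega> f < \<infinity>" if f: "locally_integrable f" for f :: "real ^ 'n \<Rightarrow> 'b"
    using le_less_trans[OF upper[OF f], of \<infinity>] le_less_trans[OF lower[OF f], of \<infinity>]
    by (auto simp: ennreal_mult_less_top)
  then have "BMO \<omega> = BMO_X X \<omega>"
    unfolding BMO_def BMO_X_def by blast
  moreover have "ennreal (1 / C) * BMO_norm \<omega> f \<le> BMO_X_norm X \<omega> f" if f: "locally_integrable f" for f :: "real ^ 'n \<Rightarrow> 'b"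
  proof -
    have "ennreal (1 / C) * BMO_norm \<omega> f \<le> ennreal (1 / C) * (ennreal C * BMO_X_norm X \<omega> f)"
      using lower[OF f] by (rule mult_left_mono) simp
    also have "\<dots> = ennreal (1 / C * C) * BMO_X_norm X \<omega> f"
      using C by (subst ennreal_mult) (auto simp: mult.assoc)
    finally show ?thesis
      using C by simp
  qed
  ultimately show ?thesis
    using C upper by (auto simp: BMO_def intro!: exI[of _ C])
qed

end
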